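(* Let $p\ge2$ be an integer, $a,b>0$, $x_0\in\mathbb{R}^p$, $q\in\{1,2,\infty\}$, and let $\mathcal{A}_q$, $\mathcal{B}$, the linear estimators $L_n^p$, the linear minimax risk $R_p(n,\mathcal{A}_q,\mathcal{B})$ and the CFD estimator $\bar L_n^p$ be as defined in the context. For any $n\ge1$: 1. The linear minimax risk satisfies $$R_p(n,\mathcal{A}_q,\mathcal{B})\ge p^{4/3}\left(\frac{3a^2b^2}{16}\right)^{1/3}n^{-2/3}\quad\text{for } q=1,2,$$ $$R_p(n,\mathcal{A}_q,\mathcal{B})\ge p^{2/3}\left(\frac{3a^2b^2}{16}\right)^{1/3}n^{-2/3}\quad\text{for } q=\infty.$$ 2. If the budget $n$ is a multiple of $2p$, allocate $n/p$ budget to each dimension and form the CFD estimator $\bar L_n^p$ with $\delta=\left(\frac{18b}{a^2}\right)^{1/6}\frac{1}{(n/p)^{1/6}}$ on each dimension. Then $$\sup_{f\in\mathcal{A}_q,\ \sigma^2\in\mathcal{B}}E\|\bar L_n^p-\nabla f(x_0)\|_2^2\le p^{5/3}\left(\frac{3a^2b^2}{16}\right)^{1/3}n^{-2/3},$$ and the estimator $\bar L_n^p$ is optimal in the class of problems defined by $(\mathcal{A}_q,\mathcal{B})$ up to a sublinear multiplicative factor in $p$. 3. If in $L_n^p$ each coefficient $w_j$ is further restricted to have the same sign across components, i.e. $\mathrm{sign}((w_j)_k)=\mathrm{sign}((w_j)_l)$ for any $1\le k,l\le p$, then, with $R_p(n,\mathcal{A}_q,\mathcal{B})$ now denoting the linear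 minimax risk for this restricted class of linear estimators, $$R_p(n,\mathcal{A}_q,\mathcal{B})\ge p^{5/3}\left(\frac{3a^2b^2}{16}\right)^{1/3}n^{-2/3}\quad\text{for } q=1,2,$$ $$R_p(n,\mathcal{A}_q,\mathcal{B})\ge p\left(\frac{3a^2b^2}{16}\right)^{1/3}n^{-2/3}\quad\text{for } q=\infty,$$ so that the estimator $\bar L_n^p$ of part 2 is exactly optimal (for this restricted class of linear estimators) when considering the function class $\mathcal{A}_q$ with $q=1,2$.
   Context: Setting. $f:\mathbb{R}^p\to\mathbb{R}$ is an unknown function; for any chosen $x\in\mathbb{R}^p$ one can observe a random variable $Y(x)$ with $E[Y(x)]=f(x)$ and $Var(Y(x))=\sigma^2(x)$. The goal is to estimate $\nabla f(x_0)$. With budget $n\ge1$, one chooses deterministic perturbations $\delta_1,\dots,\delta_n\in\mathbb{R}^p$ and observes independent outputs $Y_j(x_0+\delta_j)$, $j=1,\dots,n$. Linear estimators: $L_n^p=\sum_{j=1}^n w_jY_j(x_0+\delta_j)$ with deterministic coefficient vectors $w_j\in\mathbb{R}^p$; $(w_j)_k$ denotes the $k$th component of $w_j$. CFD (central finite-difference) estimator ($n$ a multiple of $2p$, perturbation size $\delta>0$): the budget is divided into $n/p$ independent evaluations for each coordinate $i=1,\dots,p$, and $\bar L_n^p=[(\bar L_n^p)_i]_{i=1,\dots,p}$ where $$(\bar L_n^p)_i=\frac{1}{n/(2p)}\sum_{j=1}^{n/(2p)}\frac{Y_{2j-1}(x_0+\delta e_i)-Y_{2j}(x_0-\delta e_i)}{2\delta},$$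 with $e_i$ the $i$th standard basis vector of $\mathbb{R}^p$ (different coordinates $i$ use different independent evaluations, for a total of $n$). Problem classes, for given constants $a,b>0$: $\mathcal{A}_q$ is the set of functions $f:\mathbb{R}^p\to\mathbb{R}$ such that $\nabla^2f(x_0)$ exists and, for all $x\in\mathbb{R}^p$, $$\left|f(x)-f(x_0)-\nabla f(x_0)^T(x-x_0)-\tfrac12(x-x_0)^T\nabla^2f(x_0)(x-x_0)\right|\le\tfrac a6\|x-x_0\|_q^3,$$ with $\|\cdot\|_q$ the $\ell_q$-norm. $\mathcal{B}$ is the set of variance functions $\sigma^2(\cdot)$ on $\mathbb{R}^p$ with $\sigma^2(x)\le b$ for all $x$. Linear minimax $L_2$-risk: $$R_p(n,\mathcal{A}_q,\mathcal{B})=\inf_{\delta_1,\dots,\delta_n,\ w_1,\dots,w_n\in\mathbb{R}^p}\ \ \sup_{f\in\mathcal{A}_q,\ \sigma^2\in\mathcal{B}}E\|L_n^p-\nabla f(x_0)\|_2^2 .$$ Optimality of an estimator refers to its worst-case risk $\sup_{f\in\mathcal{A}_q,\sigma^2\in\mathcal{B}}E\|\cdot-\nabla f(x_0)\|_2^2$ compared with the linear minimax risk.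
   Formalization: In part 3 with q=2,∞ the coefficients summed over coinciding perturbations must also have one sign (zeros allowed); for q=∞ the factor in part 2 is p, not o(p); exact attainment by CFD lets zero components agree with either sign (for strict signs: CFD risk ≤ minimax). *)

theory Defs
  imports
    "HOL-Probability.Probability"
    "HOL-Library.Extended_Nat"
    "HOL-Library.Landau_Symbols"
begin

section \<open>Gradient, Hessian and the problem classes\<close>

definition grad :: "(real ^ 'p \<Rightarrow> real) \<Rightarrow> real ^ 'p \<Rightarrow> real ^ 'p" where
  "grad f x = (THE g. GDERIV f x :> g)"

text \<open>\<open>H\<close> is the derivative at \<open>x\<close> of the gradient map, which has to be defined near \<open>x\<close> only.\<close>
definition has_hessian :: "(real ^ 'p \<Rightarrow> real) \<Rightarrow> real ^ 'p ^ 'p \<Rightarrow> real ^ 'p \<Rightarrow> bool" where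
  "has_hessian f H x \<longleftrightarrow>
     (\<forall>\<^sub>F y in nhds x. GDERIV f y :> grad f y) \<and> (grad f has_derivative (\<lambda>h. H *v h)) (at x)"

definition lq_norm :: "enat \<Rightarrow> real ^ 'p \<Rightarrow> real" where
  "lq_norm q x = (case q of enat m \<Rightarrow> root m (\<Sum>i\<in>UNIV. \<bar>x $ i\<bar> ^ m) | \<infinity> \<Rightarrow> infnorm x)"

definition class_A :: "real \<Rightarrow> real ^ 'p \<Rightarrow> enat \<Rightarrow> (real ^ 'p \<Rightarrow> real) set" where
  "class_A a x0 q = {f. \<exists>H. has_hessian f H x0 \<and>
     (\<forall>x. \<bar>f x - f x0 - grad f x0 \<bullet> (x - x0) - 1/2 * ((x - x0) \<bullet> (H *v (x - x0)))\<bar>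
            \<le> a / 6 * lq_norm q (x - x0) ^ 3)}"

definition class_B :: "real \<Rightarrow> (real ^ 'p \<Rightarrow> real) set" where
  "class_B b = {s. \<forall>x. 0 \<le> s x \<and> s x \<le> b}"


section \<open>Observations and risk\<close>

text \<open>\<open>D x\<close> is the law of the output \<open>Y(x)\<close>; its mean is \<open>f x\<close> and its variance is \<open>s x\<close>.\<close>
definition output_laws ::
    "(real ^ 'p \<Rightarrow> real) \<Rightarrow> (real ^ 'p \<Rightarrow> real) \<Rightarrow> (real ^ 'p \<Rightarrow> real measure) set" where
  "output_laws f s = {D. \<forall>x. prob_space (D x) \<and> sets (D x) = sets borel \<and>
     integrable (D x) (\<lambda>y. y) \<and> integrable (D x) (\<lambda>y. y\<^sup>2) \<and>
     (\<integral>y. y \<partial>D x) = f x \<and> (\<integral>y. (y - f x)\<^sup>2 \<partial>D x) = s x}"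

text \<open>
  Independent outputs are observed at the points \<open>pt i\<close>, \<open>i \<in> I\<close>, so that their joint law is a
  product measure; \<open>T\<close> computes the estimate from the outputs. The value is infinite if the
  worst-case risk is unbounded. For linear \<open>T\<close>, the mean squared error depends on \<open>D\<close> only
  through \<open>f\<close> and \<open>s\<close>, so the supremum over \<open>D\<close> has no effect on the supremum over \<open>f\<close> and \<open>s\<close>.
\<close>
definition worst_risk ::
    "(real ^ 'p \<Rightarrow> real) set \<Rightarrow> (real ^ 'p \<Rightarrow> real) set \<Rightarrow> real ^ 'p \<Rightarrow>
     'i set \<Rightarrow> ('i \<Rightarrow> real ^ 'p) \<Rightarrow> (('i \<Rightarrow> real) \<Rightarrow> real ^ 'p) \<Rightarrow> ennreal" where
  "worst_risk A B x0 I pt T =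
     (SUP f\<in>A. SUP s\<in>B. SUP D\<in>output_laws f s.
        \<integral>\<^sup>+ y. ennreal ((norm (T y - grad f x0))\<^sup>2) \<partial>PiM I (\<lambda>i. D (pt i)))"

definition linear_risk ::
    "(real ^ 'p \<Rightarrow> real) set \<Rightarrow> (real ^ 'p \<Rightarrow> real) set \<Rightarrow> real ^ 'p \<Rightarrow> nat \<Rightarrow>
     (nat \<Rightarrow> real ^ 'p) \<Rightarrow> (nat \<Rightarrow> real ^ 'p) \<Rightarrow> ennreal" where
  "linear_risk A B x0 n \<delta> w =
     worst_risk A B x0 {1..n} (\<lambda>j. x0 + \<delta> j) (\<lambda>y. \<Sum>j=1..n. y j *\<^sub>R w j)"

text \<open>The set \<open>C\<close> collects the admissible choices of perturbations and coefficients.\<close>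
definition minimax_risk ::
    "((nat \<Rightarrow> real ^ 'p) \<times> (nat \<Rightarrow> real ^ 'p)) set \<Rightarrow>
     (real ^ 'p \<Rightarrow> real) set \<Rightarrow> (real ^ 'p \<Rightarrow> real) set \<Rightarrow> real ^ 'p \<Rightarrow> nat \<Rightarrow> ennreal" where
  "minimax_risk C A B x0 n = (INF (\<delta>, w)\<in>C. linear_risk A B x0 n \<delta> w)"


section \<open>The central finite-difference estimator\<close>

text \<open>
  The output with index \<open>(i, m)\<close>, \<open>1 \<le> m \<le> n/p\<close>, is the \<open>m\<close>-th evaluation devoted to
  coordinate \<open>i\<close>; odd \<open>m\<close> are evaluated at \<open>x0 + \<delta> e\<^sub>i\<close> and even \<open>m\<close> at \<open>x0 - \<delta> e\<^sub>i\<close>.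
\<close>
definition cfd_point :: "real ^ 'p \<Rightarrow> real \<Rightarrow> 'p \<times> nat \<Rightarrow> real ^ 'p" where
  "cfd_point x0 \<delta> = (\<lambda>(i, m). if odd m then x0 + \<delta> *\<^sub>R axis i 1 else x0 - \<delta> *\<^sub>R axis i 1)"

definition cfd_estimate :: "nat \<Rightarrow> real \<Rightarrow> ('p \<times> nat \<Rightarrow> real) \<Rightarrow> real ^ 'p" where
  "cfd_estimate n \<delta> y =
     (\<chi> i. 1 / (real n / (2 * real CARD('p))) *
            (\<Sum>j = 1..n div (2 * CARD('p)). (y (i, 2 * j - 1) - y (i, 2 * j)) / (2 * \<delta>)))"

definition cfd_risk ::
    "(real ^ 'p \<Rightarrow> real) set \<Rightarrow> (real ^ 'p \<Rightarrow> real) set \<Rightarrow> real ^ 'p \<Rightarrow> nat \<Rightarrow> real \<Rightarrow> ennreal" where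
  "cfd_risk A B x0 n \<delta> =
     worst_risk A B x0 (UNIV \<times> {1..n div CARD('p)}) (cfd_point x0 \<delta>) (cfd_estimate n \<delta>)"


section \<open>Sign restrictions on the coefficients\<close>

definition same_sign :: "real ^ 'p \<Rightarrow> bool" where
  "same_sign v \<longleftrightarrow> (\<forall>k l. sgn (v $ k) = sgn (v $ l))"

text \<open>
  Here a zero component agrees with either sign. The coefficients of the central
  finite-difference estimator are multiples of the vectors \<open>e\<^sub>i\<close>, so they satisfy this condition
  but not the previous one.
\<close>
definition same_sign0 :: "real ^ 'p \<Rightarrow> bool" where
  "same_sign0 v \<longleftrightarrow> (\<forall>k l. v $ k = 0 \<or> v $ l = 0 \<or> sgn (v $ k) = sgn (v $ l))"

definition sign_restricted ::
    "(real ^ 'p \<Rightarrow> bool) \<Rightarrow> nat \<Rightarrow> ((nat \<Rightarrow> real ^ 'p) \<times> (nat \<Rightarrow> real ^ 'p)) set" where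
  "sign_restricted S n = {(\<delta>, w). \<forall>j\<in>{1..n}. S (w j)}"

text \<open>
  Repeated perturbations contribute to the mean of the estimator only through the sum of their
  coefficients, and every vector is a sum of two vectors that satisfy \<open>same_sign\<close>. The sign
  restriction therefore has to hold for these sums too in order to bound the bias; it is
  automatic there if the perturbations are pairwise distinct, or if equal perturbations have
  equal coefficients.
\<close>
definition merged_same_sign :: "nat \<Rightarrow> ((nat \<Rightarrow> real ^ 'p) \<times> (nat \<Rightarrow> real ^ 'p)) set" where
  "merged_same_sign n =
     {(\<delta>, w). \<forall>i\<in>{1..n}. same_sign0 (\<Sum>j | j \<in> {1..n} \<and> \<delta> j = \<delta> i. w j)}"

end

theory Submission
  imports Defs "HOL-Real_Asymp.Real_Asymp"
begin

text \<open>
  The mean squared error of a linear estimator is its squared bias plus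
  \<open>\<Sum>\<^sub>j \<sigma>\<^sup>2(x\<^sub>0 + \<delta>\<^sub>j) \<parallel>w\<^sub>j\<parallel>\<^sup>2\<close>. Linear functions \<open>f\<close> force \<open>\<Sum>\<^sub>j w\<^sub>j \<delta>\<^sub>j\<^sup>T = I\<close> unless the worst-case risk is
  infinite; its trace gives \<open>p = \<Sum>\<^sub>x u\<^sub>x \<bullet> x\<close>, where \<open>u\<^sub>x\<close> is the sum of the \<open>w\<^sub>j\<close> with \<open>\<delta>\<^sub>j = x\<close>.
  Functions that vanish except at finitely many points, where they are \<open>\<plusminus>a/6 \<parallel>x\<parallel>\<^sub>q\<^sup>3\<close>, show that the
  worst squared bias is at least \<open>(a/6 \<beta>(v))\<^sup>2\<close> with \<open>\<beta>(v) = \<Sum>\<^sub>x \<bar>v \<bullet> u\<^sub>x\<bar> \<parallel>x\<parallel>\<^sub>q\<^sup>3\<close>, for every unit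
  vector \<open>v\<close>. If \<open>m\<close> is a norm with \<open>u \<bullet> x \<le> m(u) \<parallel>x\<parallel>\<^sub>q\<close>, then convexity of the cube gives
  \<open>p\<^sup>3 \<le> (\<Sum>\<^sub>x m(u\<^sub>x) \<parallel>x\<parallel>\<^sub>q\<^sup>3) (\<Sum>\<^sub>x m(u\<^sub>x))\<^sup>2\<close>. The first factor is compared with an average of \<open>\<beta>(v)\<close>, the
  second with the variance, and the bias-variance sum is minimised.

  The directions \<open>v\<close> are the axes in the unrestricted case and the main diagonal under the sign
  restriction. For \<open>q = 1\<close>, \<open>m\<close> is the maximum norm and averaging over all diagonals
  \<open>(\<plusminus>1, \<dots>, \<plusminus>1)/\<surd>p\<close> gives the rate \<open>p\<^bsup>5/3\<^esup>\<close> without any sign restriction.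
\<close>

section \<open>Mean squared error and members of the problem class\<close>

text \<open>A fair coin between \<open>m + sqrt s\<close> and \<open>m - sqrt s\<close> realises the
  two moments.\<close>

lemma two_point_law:
  fixes m s :: real
  assumes "0 \<le> s"
  obtains M where "prob_space M" "sets M = sets borel" "integrable M (\<lambda>y. y)"
    "integrable M (\<lambda>y. y\<^sup>2)" "(\<integral>y. y \<partial>M) = m" "(\<integral>y. (y - m)\<^sup>2 \<partial>M) = s"
proof
  let ?P = "measure_pmf (bernoulli_pmf (1/2))"
  let ?g = "\<lambda>c. if c then m + sqrt s else m - sqrt s"
  let ?M = "distr ?P borel ?g"
  have g: "?g \<in> measurable ?P borel" by simp
  have int: "integrable ?M (h::real \<Rightarrow> real)" if "h \<in> borel_measurable borel" for h
    using that by (simp add: integrable_distr_eq integrable_measure_pmf_finite)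
  show "prob_space ?M" by (rule prob_space.prob_space_distr) (auto simp: prob_space_measure_pmf)
  show "sets ?M = sets borel" by simp
  show "integrable ?M (\<lambda>y. y)" "integrable ?M (\<lambda>y. y\<^sup>2)" by (auto intro!: int)
  show "(\<integral>y. y \<partial>?M) = m" by (simp add: integral_distr field_simps)
  show "(\<integral>y. (y - m)\<^sup>2 \<partial>?M) = s" using assms by (simp add: integral_distr)
qed

text \<open>The supremum over laws in \<open>worst_risk\<close> would be 0 over an empty set;
  nonemptiness is what makes lower bounds possible.\<close>

lemma output_laws_nonempty:
  assumes "s \<in> class_B b"
  shows "output_laws f s \<noteq> {}"
proof -
  have "\<exists>M. prob_space M \<and> sets M = sets borel \<and> integrable M (\<lambda>y. y) \<and>
      integrable M (\<lambda>y. y\<^sup>2) \<and> (\<integral>y. y \<partial>M) = f x \<and> (\<integral>y. (y - f x)\<^sup>2 \<partial>M) = s x" for x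
    using assms two_point_law[of "s x" "f x"] unfolding class_B_def by blast
  then have "\<exists>D. \<forall>x. prob_space (D x) \<and> sets (D x) = sets borel \<and> integrable (D x) (\<lambda>y. y) \<and>
      integrable (D x) (\<lambda>y. y\<^sup>2) \<and> (\<integral>y. y \<partial>D x) = f x \<and> (\<integral>y. (y - f x)\<^sup>2 \<partial>D x) = s x"
    by (intro choice) blast
  then show ?thesis unfolding output_laws_def by blast
qed

text \<open>Bias-variance decomposition: under the product measure the centred outputs
  \<open>z i\<close> have mean 0 and are uncorrelated, so the cross terms vanish when the squared
  norm is expanded. The index set is arbitrary because the CFD outputs are indexed by pairs.\<close>

lemma nn_integral_linear_estimator:
  fixes w :: "'i \<Rightarrow> real ^ 'p"
  assumes D: "D \<in> output_laws f s" and I: "finite I"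
  shows "(\<integral>\<^sup>+ y. ennreal ((norm ((\<Sum>i\<in>I. y i *\<^sub>R w i) - g))\<^sup>2) \<partial>PiM I (\<lambda>i. D (pt i)))
    = ennreal ((norm ((\<Sum>i\<in>I. f (pt i) *\<^sub>R w i) - g))\<^sup>2 + (\<Sum>i\<in>I. s (pt i) * (norm (w i))\<^sup>2))"
proof -
  let ?M = "PiM I (\<lambda>i. D (pt i))"
  interpret product_prob_space "\<lambda>i. D (pt i)" I
    using D by (auto simp: output_laws_def product_prob_space_def product_prob_space_axioms_def
        product_sigma_finite_def intro: prob_space_imp_sigma_finite)
  define z where "z i y = y i - f (pt i)" for i and y :: "'i \<Rightarrow> real"
  define \<beta> where "\<beta> = (\<Sum>i\<in>I. f (pt i) *\<^sub>R w i) - g"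
  have M: "integrable (D x) (\<lambda>y. y)" "integrable (D x) (\<lambda>y. y\<^sup>2)" "(\<integral>y. y \<partial>D x) = f x"
    "(\<integral>y. (y - f x)\<^sup>2 \<partial>D x) = s x" "prob_space (D x)" for x
    using D by (auto simp: output_laws_def)
  have fin: "finite_measure (D x)" for x using M(5) prob_space.axioms(1) by blast
  have c1: "integrable (D x) (\<lambda>y. y - f x)" "(\<integral>y. y - f x \<partial>D x) = 0" for x
    using M(1,3)[of x] fin[of x] prob_space.prob_space[OF M(5)[of x]]
    by (auto simp: finite_measure.integrable_const)
  have c2: "integrable (D x) (\<lambda>y. (y - f x)\<^sup>2)" for x
    using M(1,2)[of x] fin[of x] by (auto simp: power2_diff finite_measure.integrable_const)
  have prods: "has_bochner_integral ?M (\<lambda>y. z i y * z j y) (if i = j then s (pt i) else 0)"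
    if "i \<in> I" "j \<in> I" for i j
  proof -
    \<comment> \<open>\<open>z i y * z j y\<close> as a product over all of \<open>I\<close> of
      functions of one coordinate each; for \<open>i = j\<close> both factors meet in the same
      coordinate and give the variance.\<close>
    define F where "F k t = (if k = i then t - f (pt k) else 1) * (if k = j then t - f (pt k) else 1)"
      for k t
    have F: "integrable (D (pt k)) (F k)"
      "(\<integral>t. F k t \<partial>D (pt k)) = (if k = i \<and> k = j then s (pt k) else if k = i \<or> k = j then 0 else 1)" for k
      using c1[of "pt k"] c2[of "pt k"] M(4)[of "pt k"] prob_space.prob_space[OF M(5)[of "pt k"]]
      by (cases "k = i"; cases "k = j"; simp add: F_def[abs_def] power2_eq_square)+
    have eq: "(\<Prod>k\<in>I. F k (y k)) = z i y * z j y" for y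
      using that I by (simp add: F_def prod.distrib z_def)
    have "(\<Prod>k\<in>I. \<integral>t. F k t \<partial>D (pt k)) = (if i = j then s (pt i) else 0)"
    proof (cases "i = j")
      case True
      then have "(\<Prod>k\<in>I. \<integral>t. F k t \<partial>D (pt k)) = (\<Prod>k\<in>I. if k = i then s (pt k) else 1)"
        by (intro prod.cong refl) (simp add: F(2))
      then show ?thesis using True that I by simp
    next
      case False
      then have "(\<integral>t. F i t \<partial>D (pt i)) = 0" by (simp add: F(2))
      then have "(\<Prod>k\<in>I. \<integral>t. F k t \<partial>D (pt k)) = 0" using that I by (intro prod_zero) auto
      then show ?thesis using False by simp
    qed
    then show ?thesis
      using product_integrable_prod[OF I, of F] product_integral_prod[OF I, of F] F(1)
      by (simp add: has_bochner_integral_iff eq)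
  qed
  have single: "has_bochner_integral ?M (z i) 0" if "i \<in> I" for i
  proof -
    define F where "F k t = (if k = i then t - f (pt k) else 1)" for k t
    have F: "integrable (D (pt k)) (F k)"
      "(\<integral>t. F k t \<partial>D (pt k)) = (if k = i then 0 else 1)" for k
      using c1[of "pt k"] prob_space.prob_space[OF M(5)[of "pt k"]]
      by (cases "k = i"; simp add: F_def[abs_def])+
    have eq: "(\<Prod>k\<in>I. F k (y k)) = z i y" for y
      using that I by (simp add: F_def z_def)
    have "(\<Prod>k\<in>I. \<integral>t. F k t \<partial>D (pt k)) = 0"
      using that I by (auto simp: F(2))
    then show ?thesis
      using product_integrable_prod[OF I, of F] product_integral_prod[OF I, of F] F(1)
      by (simp add: has_bochner_integral_iff eq)
  qed
  have expand: "(norm ((\<Sum>i\<in>I. y i *\<^sub>R w i) - g))\<^sup>2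
      = (norm \<beta>)\<^sup>2 + (\<Sum>i\<in>I. z i y * (2 * (\<beta> \<bullet> w i))) + (\<Sum>i\<in>I. \<Sum>j\<in>I. (z i y * z j y) * (w i \<bullet> w j))" for y
  proof -
    have "(\<Sum>i\<in>I. y i *\<^sub>R w i) - g = \<beta> + (\<Sum>i\<in>I. z i y *\<^sub>R w i)"
      by (simp add: \<beta>_def z_def algebra_simps sum.distrib sum_subtractf)
    then show ?thesis
      unfolding power2_norm_eq_inner
      by (simp add: inner_add inner_sum_left inner_sum_right inner_commute sum_distrib_left
          sum.distrib[symmetric] mult_ac)
  qed
  have "has_bochner_integral ?M (\<lambda>y. (norm ((\<Sum>i\<in>I. y i *\<^sub>R w i) - g))\<^sup>2)
     ((norm \<beta>)\<^sup>2 + (\<Sum>i\<in>I. 0 * (2 * (\<beta> \<bullet> w i)))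
       + (\<Sum>i\<in>I. \<Sum>j\<in>I. (if i = j then s (pt i) else 0) * (w i \<bullet> w j)))"
    unfolding expand
    by (intro has_bochner_integral_add has_bochner_integral_sum has_bochner_integral_mult_left
        prods single) (auto simp: has_bochner_integral_iff P.prob_space)
  moreover have "(\<Sum>i\<in>I. \<Sum>j\<in>I. (if i = j then s (pt i) else 0) * (w i \<bullet> w j))
      = (\<Sum>i\<in>I. s (pt i) * (norm (w i))\<^sup>2)"
    using I by (intro sum.cong refl) (simp add: if_distrib[of "\<lambda>x. x * _"] power2_norm_eq_inner cong: if_cong)
  ultimately show ?thesis
    by (subst nn_integral_eq_integral) (auto simp: has_bochner_integral_iff \<beta>_def)
qed

section \<open>Gradients and Hessians\<close>

lemma GDERIV_unique:
  assumes "GDERIV f x :> g" "GDERIV f x :> h"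
  shows "g = h"
proof -
  have "(\<lambda>u. u \<bullet> g) = (\<lambda>u. u \<bullet> h)"
    using assms unfolding gderiv_def by (rule has_derivative_unique)
  then show ?thesis unfolding fun_eq_iff vector_eq_ldot .
qed

lemma grad_eqI: "GDERIV f x :> g \<Longrightarrow> grad f x = g"
  unfolding grad_def using GDERIV_unique by blast

text \<open>Both derivatives are local at \<open>x0\<close>. This serves linear functions with
  \<open>U = UNIV\<close>, and functions supported on finitely many points with
  \<open>g = 0\<close>.\<close>

lemma locally_affine_grad_hessian:
  fixes f :: "real ^ 'p \<Rightarrow> real"
  assumes "open U" "x0 \<in> U" and f: "\<And>x. x \<in> U \<Longrightarrow> f x = g \<bullet> (x - x0)"
  shows "grad f x0 = g" and "has_hessian f 0 x0"
proof -
  have D: "GDERIV f y :> g" if "y \<in> U" for y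
  proof -
    have "((\<lambda>x. g \<bullet> (x - x0)) has_derivative (\<lambda>h. h \<bullet> g)) (at y)"
      by (auto intro!: derivative_eq_intros simp: inner_commute)
    then show ?thesis
      unfolding gderiv_def
      by (rule has_derivative_transform_within_open[OF _ \<open>open U\<close> that]) (simp add: f)
  qed
  note G = grad_eqI[OF D]
  show "grad f x0 = g" using G assms(2) .
  have "((\<lambda>x. g) has_derivative (\<lambda>h. 0 *v h)) (at x0)" by simp
  then have "(grad f has_derivative (\<lambda>h. 0 *v h)) (at x0)"
    by (rule has_derivative_transform_within_open[OF _ assms(1,2)]) (simp add: G)
  moreover have "\<forall>\<^sub>F y in nhds x0. GDERIV f y :> grad f y"
    unfolding eventually_nhds using assms(1,2) D G by metis
  ultimately show "has_hessian f 0 x0" by (simp add: has_hessian_def)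
qed

section \<open>The three norms\<close>

lemma lq_norm_1: "lq_norm 1 x = (\<Sum>i\<in>UNIV. \<bar>x $ i\<bar>)"
  by (simp add: lq_norm_def one_enat_def)

lemma lq_norm_2: "lq_norm 2 x = norm x"
  by (simp add: lq_norm_def numeral_eq_enat norm_vec_def L2_set_def sqrt_def)

lemma lq_norm_infinity: "lq_norm \<infinity> x = infnorm x"
  by (simp add: lq_norm_def)

lemmas lq_norms = lq_norm_1 lq_norm_2 lq_norm_infinity

lemma lq_norm_nonneg: "q \<in> {1, 2, \<infinity>} \<Longrightarrow> 0 \<le> lq_norm q x"
  by (auto simp: lq_norms sum_nonneg infnorm_pos_le)

lemma lq_norm_zero: "q \<in> {1, 2, \<infinity>} \<Longrightarrow> lq_norm q 0 = 0"
  by (auto simp: lq_norms infnorm_0)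

lemma component_le_infnorm: "\<bar>x $ i\<bar> \<le> infnorm x"
  using Basis_le_infnorm[of "axis i 1" x] by (auto simp: inner_axis)

lemma infnorm_leI: "(\<And>i. \<bar>x $ i\<bar> \<le> c) \<Longrightarrow> infnorm x \<le> c"
  unfolding infnorm_cart by (rule cSup_least) auto

lemma norm_axis_eq: "norm (axis i c :: real ^ 'p) = \<bar>c\<bar>"
  by (simp add: norm_eq_sqrt_inner inner_axis)

lemma lq_norm_axis: "q \<in> {1, 2, \<infinity>} \<Longrightarrow> lq_norm q (axis i c :: real ^ 'p) = \<bar>c\<bar>"
proof -
  have "infnorm (axis i c) = \<bar>c\<bar>"
    using component_le_infnorm[of "axis i c" i] infnorm_leI[of "axis i c" "\<bar>c\<bar>"]
    by (auto simp: axis_def)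
  moreover have "(\<Sum>j\<in>UNIV. \<bar>axis i c $ j\<bar>) = \<bar>c\<bar>"
    by (simp add: axis_def if_distrib cong: if_cong)
  ultimately show "q \<in> {1, 2, \<infinity>} \<Longrightarrow> ?thesis" by (auto simp: lq_norms norm_axis_eq)
qed

section \<open>Linear functions and bumps in the problem class\<close>

lemma linear_in_class_A:
  assumes "0 \<le> a" "q \<in> {1, 2, \<infinity>}"
  shows "(\<lambda>x. g \<bullet> (x - x0)) \<in> class_A a x0 q"
proof -
  note L = locally_affine_grad_hessian[of UNIV x0 "\<lambda>x. g \<bullet> (x - x0)" g, simplified]
  show ?thesis
    unfolding class_A_def using L lq_norm_nonneg[OF assms(2)] assms(1)
    by (auto intro!: exI[of _ 0] mult_nonneg_nonneg)
qed

text \<open>Membership in the class only constrains the values of a function away from \<open>x0\<close>, without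
  any continuity, so that arbitrary signs can be prescribed at finitely many points.\<close>

lemma bump_in_class_A:
  fixes x0 :: "real ^ 'p"
  assumes "0 \<le> a" "q \<in> {1, 2, \<infinity>}" "finite P" "\<And>x. \<bar>e x\<bar> \<le> (1::real)"
  defines "f \<equiv> \<lambda>x. if x \<in> P then e x * (a / 6 * lq_norm q (x - x0) ^ 3) else 0"
  shows "f \<in> class_A a x0 q" and "grad f x0 = 0"
proof -
  \<comment> \<open>The point \<open>x0\<close> may lie in \<open>P\<close>; it can stay in the open
    set because the bump has height 0 there.\<close>
  have "open (- (P - {x0}))" using assms(3) by (intro open_Compl finite_imp_closed) simp
  then have L: "grad f x0 = 0" "has_hessian f 0 x0"
    by (intro locally_affine_grad_hessian[of "- (P - {x0})" x0 f 0];
        auto simp: f_def lq_norm_zero[OF assms(2)])+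
  then show "grad f x0 = 0" by simp
  have "\<bar>f x\<bar> \<le> a / 6 * lq_norm q (x - x0) ^ 3" for x
    using mult_right_mono[OF assms(4)[of x], of "a / 6 * lq_norm q (x - x0) ^ 3"]
      lq_norm_nonneg[OF assms(2), of "x - x0"] assms(1)
    by (auto simp: f_def abs_mult)
  moreover have "f x0 = 0" by (simp add: f_def lq_norm_zero[OF assms(2)])
  ultimately show "f \<in> class_A a x0 q"
    unfolding class_A_def using L by (auto intro!: exI[of _ 0])
qed

section \<open>Lower bounds on the risk\<close>

text \<open>A lower bound on bias times variance bounds the sum \<open>X + Y\<close> of squared bias
  and variance through \<open>27/4 * X * Y\<^sup>2 \<le> (X + Y) ^ 3\<close>. Cubing turns the
  fractional powers into polynomials.\<close>

lemma risk_tradeoff: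
  fixes a b c n V \<beta> :: real
  assumes "0 < n" "0 \<le> \<beta>" "0 \<le> b" "0 \<le> V" "0 \<le> c" and c: "c \<le> \<beta> * (n * V)"
  shows "c powr (2/3) * ((3 * a\<^sup>2 * b\<^sup>2 / 16) powr (1/3) * n powr (-2/3)) \<le> (a / 6 * \<beta>)\<^sup>2 + b * V"
    (is "?L \<le> _")
proof -
  define X where "X = (a / 6 * \<beta>)\<^sup>2"
  define Y where "Y = b * V"
  have nn: "0 \<le> X" "0 \<le> Y" using assms by (auto simp: X_def Y_def)
  have cube: "(x powr r) ^ 3 = x powr (3 * r)" for x r :: real
    by (simp add: powr_powr mult.commute flip: powr_numeral)
  have "?L ^ 3 = c\<^sup>2 * (3 * a\<^sup>2 * b\<^sup>2 / 16) / n\<^sup>2"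
  proof -
    have cubes: "(c powr (2/3)) ^ 3 = c\<^sup>2" "(n powr (-2/3)) ^ 3 = 1 / n\<^sup>2"
      "((3 * a\<^sup>2 * b\<^sup>2 / 16) powr (1/3)) ^ 3 = 3 * a\<^sup>2 * b\<^sup>2 / 16"
      using assms cube[of n "-2/3"] by (simp_all add: cube powr_minus_divide powr_numeral)
    show ?thesis unfolding power_mult_distrib cubes by simp
  qed
  also have "\<dots> = (c / n)\<^sup>2 * (3 * a\<^sup>2 * b\<^sup>2 / 16)" by (simp add: power_divide)
  also have "\<dots> \<le> (\<beta> * V)\<^sup>2 * (3 * a\<^sup>2 * b\<^sup>2 / 16)"
    using assms by (intro mult_right_mono power_mono) (auto simp: field_simps)
  \<comment> \<open>The constant 3/16 is 27/4 times the 1/36 from the squared bias.\<close>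
  also have "\<dots> = 27 / 4 * X * Y\<^sup>2"
    by (simp add: X_def Y_def power2_eq_square)
  also have "\<dots> \<le> (X + Y) ^ 3"
  proof -
    \<comment> \<open>The double root \<open>X = Y / 2\<close> is the optimal balance, with squared
      bias equal to half the variance.\<close>
    have "(X + Y) ^ 3 - 27 / 4 * X * Y\<^sup>2 = (X - Y / 2)\<^sup>2 * (X + 4 * Y)"
      by (simp add: power2_eq_square power3_eq_cube field_simps)
    moreover have "0 \<le> (X - Y / 2)\<^sup>2 * (X + 4 * Y)" using nn by simp
    ultimately show ?thesis by linarith
  qed
  finally show ?thesis
    using nn power_le_imp_le_base[of ?L 2 "X + Y"] by (simp add: X_def Y_def numeral_3_eq_3)
qed

text \<open>Jensen's inequality for the cube with weights \<open>m i\<close>, cleared of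
  denominators and obtained from the tangent at the weighted mean \<open>\<tau>\<close>.\<close>

lemma sum_mult_cube_le:
  fixes m t :: "'i \<Rightarrow> real"
  assumes "\<And>i. i \<in> P \<Longrightarrow> 0 \<le> m i" "\<And>i. i \<in> P \<Longrightarrow> 0 \<le> t i"
  shows "(\<Sum>i\<in>P. m i * t i) ^ 3 \<le> (\<Sum>i\<in>P. m i * t i ^ 3) * (\<Sum>i\<in>P. m i)\<^sup>2"
proof (cases "(\<Sum>i\<in>P. m i) = 0 \<or> infinite P")
  \<comment> \<open>There is no weighted mean to divide out here; both sides are 0.\<close>
  case True
  then have "(\<Sum>i\<in>P. m i * t i) = 0"
    using assms(1) by (cases "finite P") (auto simp: sum_nonneg_eq_0_iff)
  then show ?thesis using True by auto
next
  case False
  define M where "M = (\<Sum>i\<in>P. m i)"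
  define T where "T = (\<Sum>i\<in>P. m i * t i)"
  define \<tau> where "\<tau> = T / M"
  have M: "0 < M" using False assms(1) by (simp add: M_def sum_nonneg order_le_neq_trans)
  have "0 \<le> \<tau>" using assms M by (simp add: \<tau>_def T_def sum_nonneg)
  have tangent: "3 * \<tau>\<^sup>2 * s - 2 * \<tau> ^ 3 \<le> s ^ 3" if "0 \<le> s" for s
  proof -
    have "s ^ 3 - (3 * \<tau>\<^sup>2 * s - 2 * \<tau> ^ 3) = (s - \<tau>)\<^sup>2 * (s + 2 * \<tau>)"
      by (simp add: power2_eq_square power3_eq_cube algebra_simps)
    moreover have "0 \<le> (s - \<tau>)\<^sup>2 * (s + 2 * \<tau>)" using that \<open>0 \<le> \<tau>\<close> by simp
    ultimately show ?thesis by linarith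
  qed
  have "3 * \<tau>\<^sup>2 * T - 2 * \<tau> ^ 3 * M = (\<Sum>i\<in>P. m i * (3 * \<tau>\<^sup>2 * t i - 2 * \<tau> ^ 3))"
    by (simp add: T_def M_def right_diff_distrib sum_subtractf sum_distrib_left sum_distrib_right mult_ac)
  also have "\<dots> \<le> (\<Sum>i\<in>P. m i * t i ^ 3)"
    using assms by (intro sum_mono mult_left_mono tangent)
  finally have "T ^ 3 / M\<^sup>2 \<le> (\<Sum>i\<in>P. m i * t i ^ 3)"
    using M by (simp add: \<tau>_def power_divide power2_eq_square power3_eq_cube field_simps)
  then show ?thesis using M by (simp add: divide_le_eq M_def[symmetric] T_def[symmetric])
qed

section \<open>Lower bounds for a fixed linear estimator\<close>

lemma worst_risk_ge:
  assumes "f \<in> A" "s \<in> class_B b" "finite I"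
  shows "ennreal ((norm ((\<Sum>i\<in>I. f (pt i) *\<^sub>R w i) - grad f x0))\<^sup>2 + (\<Sum>i\<in>I. s (pt i) * (norm (w i))\<^sup>2))
    \<le> worst_risk A (class_B b) x0 I pt (\<lambda>y. \<Sum>i\<in>I. y i *\<^sub>R w i)"
proof -
  obtain D where "D \<in> output_laws f s" using output_laws_nonempty[OF assms(2)] by blast
  with assms show ?thesis
    unfolding worst_risk_def nn_integral_linear_estimator[OF \<open>D \<in> _\<close> assms(3), symmetric]
    by (intro SUP_upper2[of f] SUP_upper2[of s] SUP_upper2[of D]) auto
qed

text \<open>Linear functions have no remainder, so scaling the slope \<open>g\<close> by any
  \<open>t\<close> stays in the class while the squared bias grows like
  \<open>t\<^sup>2\<close>.\<close>

lemma worst_risk_not_reproducing: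
  fixes w pt :: "'i \<Rightarrow> real ^ 'p"
  assumes "0 \<le> a" "0 \<le> b" "q \<in> {1, 2, \<infinity>}" "finite I"
    and g: "(\<Sum>i\<in>I. (g \<bullet> (pt i - x0)) *\<^sub>R w i) \<noteq> g"
  shows "worst_risk (class_A a x0 q) (class_B b) x0 I pt (\<lambda>y. \<Sum>i\<in>I. y i *\<^sub>R w i) = \<infinity>"
    (is "?W = _")
proof (rule ccontr)
  define c where "c = (norm ((\<Sum>i\<in>I. (g \<bullet> (pt i - x0)) *\<^sub>R w i) - g))\<^sup>2"
  have c: "0 < c" using g by (simp add: c_def)
  assume "?W \<noteq> \<infinity>"
  then obtain r where r: "?W = ennreal r" "0 \<le> r" by (cases ?W) auto
  \<comment> \<open>Chosen to make the squared bias \<open>t\<^sup>2 * c = r + c\<close>, just above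
    the supposed finite risk \<open>r\<close>.\<close>
  define t where "t = sqrt (r / c + 1)"
  have "grad (\<lambda>x. (t *\<^sub>R g) \<bullet> (x - x0)) x0 = t *\<^sub>R g"
    by (rule locally_affine_grad_hessian[of UNIV]) auto
  moreover have "(\<Sum>i\<in>I. ((t *\<^sub>R g) \<bullet> (pt i - x0)) *\<^sub>R w i) - t *\<^sub>R g
      = t *\<^sub>R ((\<Sum>i\<in>I. (g \<bullet> (pt i - x0)) *\<^sub>R w i) - g)"
    by (simp add: scaleR_right_diff_distrib scaleR_sum_right)
  moreover have "(norm (t *\<^sub>R ((\<Sum>i\<in>I. (g \<bullet> (pt i - x0)) *\<^sub>R w i) - g)))\<^sup>2 = t\<^sup>2 * c"
    by (simp add: c_def power_mult_distrib)
  ultimately have "ennreal (t\<^sup>2 * c) \<le> ?W"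
    using worst_risk_ge[OF linear_in_class_A[OF assms(1,3), of "t *\<^sub>R g" x0], of "\<lambda>_. 0" b I pt w x0] assms
    by (simp add: class_B_def)
  then have "t\<^sup>2 * c \<le> r" using r by simp
  moreover have "t\<^sup>2 * c = r + c" using r c by (simp add: t_def field_simps)
  ultimately show False using c by simp
qed

text \<open>All observations at one point share one value of \<open>f\<close>, hence the merged
  weights. Giving the bump at \<open>x\<close> the sign of \<open>v \<bullet> u x\<close> makes the
  contributions to the bias along \<open>v\<close> add up without cancellation; the variance is
  \<open>b\<close> everywhere.\<close>

lemma worst_risk_ge_bump:
  fixes w pt :: "'i \<Rightarrow> real ^ 'p"
  assumes "0 \<le> a" "0 \<le> b" "q \<in> {1, 2, \<infinity>}" "finite I" "norm v \<le> 1"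
  shows "ennreal ((a / 6 * (\<Sum>x\<in>pt ` I. lq_norm q (x - x0) ^ 3 * \<bar>v \<bullet> (\<Sum>i | i \<in> I \<and> pt i = x. w i)\<bar>))\<^sup>2
      + b * (\<Sum>i\<in>I. (norm (w i))\<^sup>2))
    \<le> worst_risk (class_A a x0 q) (class_B b) x0 I pt (\<lambda>y. \<Sum>i\<in>I. y i *\<^sub>R w i)"
proof -
  define u where "u x = (\<Sum>i | i \<in> I \<and> pt i = x. w i)" for x
  define c where "c x = a / 6 * lq_norm q (x - x0) ^ 3" for x
  define f where "f = (\<lambda>x. if x \<in> pt ` I then sgn (v \<bullet> u x) * (a / 6 * lq_norm q (x - x0) ^ 3) else 0)"
  have f: "f \<in> class_A a x0 q" "grad f x0 = 0"
    unfolding f_def using assms by (intro bump_in_class_A; auto simp: sgn_real_def)+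
  have "v \<bullet> (\<Sum>i\<in>I. f (pt i) *\<^sub>R w i) = (\<Sum>i\<in>I. f (pt i) * (v \<bullet> w i))"
    by (simp add: inner_sum_right)
  also have "\<dots> = (\<Sum>x\<in>pt ` I. \<Sum>i | i \<in> I \<and> pt i = x. f (pt i) * (v \<bullet> w i))"
    using assms(4) by (rule sum.image_gen)
  also have "\<dots> = (\<Sum>x\<in>pt ` I. f x * (v \<bullet> u x))"
    by (intro sum.cong refl) (simp add: u_def inner_sum_right sum_distrib_left)
  also have "\<dots> = (\<Sum>x\<in>pt ` I. c x * \<bar>v \<bullet> u x\<bar>)"
    by (intro sum.cong refl) (simp add: f_def c_def abs_sgn mult_ac)
  also have "\<dots> = a / 6 * (\<Sum>x\<in>pt ` I. lq_norm q (x - x0) ^ 3 * \<bar>v \<bullet> u x\<bar>)"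
    by (simp add: c_def sum_distrib_left mult_ac)
  finally have eq: "v \<bullet> (\<Sum>i\<in>I. f (pt i) *\<^sub>R w i) = \<dots>" .
  have "\<bar>v \<bullet> (\<Sum>i\<in>I. f (pt i) *\<^sub>R w i)\<bar> \<le> norm v * norm (\<Sum>i\<in>I. f (pt i) *\<^sub>R w i)"
    by (rule Cauchy_Schwarz_ineq2)
  also have "\<dots> \<le> norm (\<Sum>i\<in>I. f (pt i) *\<^sub>R w i)"
    using assms(5) by (intro mult_left_le_one_le) auto
  finally have "(a / 6 * (\<Sum>x\<in>pt ` I. lq_norm q (x - x0) ^ 3 * \<bar>v \<bullet> u x\<bar>))\<^sup>2
      \<le> (norm (\<Sum>i\<in>I. f (pt i) *\<^sub>R w i))\<^sup>2"
    unfolding eq by (intro abs_le_square_iff[THEN iffD1]) simp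
  then have "ennreal ((a / 6 * (\<Sum>x\<in>pt ` I. lq_norm q (x - x0) ^ 3 * \<bar>v \<bullet> u x\<bar>))\<^sup>2
        + b * (\<Sum>i\<in>I. (norm (w i))\<^sup>2))
      \<le> ennreal ((norm ((\<Sum>i\<in>I. f (pt i) *\<^sub>R w i) - grad f x0))\<^sup>2 + (\<Sum>i\<in>I. b * (norm (w i))\<^sup>2))"
    by (intro ennreal_leI) (simp add: f(2) sum_distrib_left)
  also have "\<dots> \<le> worst_risk (class_A a x0 q) (class_B b) x0 I pt (\<lambda>y. \<Sum>i\<in>I. y i *\<^sub>R w i)"
    using assms(2,4) by (intro worst_risk_ge[where s = "\<lambda>_. b"] f(1)) (auto simp: class_B_def)
  finally show ?thesis by (simp add: u_def)
qed

lemma reproducing_trace: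
  fixes w d :: "'i \<Rightarrow> real ^ 'p"
  assumes "\<And>g. (\<Sum>i\<in>I. (g \<bullet> d i) *\<^sub>R w i) = g"
  shows "(\<Sum>i\<in>I. w i \<bullet> d i) = real CARD('p)"
proof -
  have "(\<Sum>i\<in>I. w i $ k * d i $ k) = 1" for k
    using arg_cong[OF assms[of "axis k 1"], of "\<lambda>x. x $ k"]
    by (simp add: inner_axis' mult.commute)
  then have "(\<Sum>k\<in>UNIV. \<Sum>i\<in>I. w i $ k * d i $ k) = real CARD('p)" by simp
  then show ?thesis by (subst (asm) sum.swap) (simp add: inner_vec_def)
qed

text \<open>The estimator weight attached to a point is the sum of the weights of all observations made
  there. The functional \<open>m\<close> measures these weights: it is dual to the \<open>\<ell>\<^sub>q\<close>-norm, it is controlled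
  by \<open>D\<close> times the Euclidean norm, which is what the variance sees, and by an average over the
  directions \<open>v j\<close>, along which the bias is tested.\<close>

lemma worst_risk_lower_bound:
  fixes w pt :: "'i \<Rightarrow> real ^ 'p" and v :: "'j \<Rightarrow> real ^ 'p" and m :: "real ^ 'p \<Rightarrow> real"
  assumes ab: "0 \<le> a" "0 \<le> b" and q: "q \<in> {1, 2, \<infinity>}" and I: "finite I" "I \<noteq> {}"
    and dual: "\<And>u x. u \<bullet> x \<le> m u * lq_norm q x"
    and triangle: "\<And>u u'. m (u + u') \<le> m u + m u'"
    and nonneg: "\<And>u. 0 \<le> m u" and le_norm: "\<And>u. m u \<le> D * norm u"
    and J: "finite J" "J \<noteq> {}" and v: "\<And>j. norm (v j) \<le> 1"
    and avg: "\<And>x. x \<in> pt ` I \<Longrightarrow> real (card J) * m (\<Sum>i | i \<in> I \<and> pt i = x. w i)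
        \<le> C * (\<Sum>j\<in>J. \<bar>v j \<bullet> (\<Sum>i | i \<in> I \<and> pt i = x. w i)\<bar>)"
    and C: "0 < C" "0 < D" "C * D\<^sup>2 * real CARD('p) powr (3/2 * e) = real CARD('p) ^ 3"
  shows "ennreal (real CARD('p) powr e *
        ((3 * a\<^sup>2 * b\<^sup>2 / 16) powr (1/3) * real (card I) powr (-2/3)))
    \<le> worst_risk (class_A a x0 q) (class_B b) x0 I pt (\<lambda>y. \<Sum>i\<in>I. y i *\<^sub>R w i)"
proof (cases "\<forall>g. (\<Sum>i\<in>I. (g \<bullet> (pt i - x0)) *\<^sub>R w i) = g")
  case False
  then show ?thesis using worst_risk_not_reproducing[OF ab q I(1)] by fastforce
next
  case True
  define u where "u x = (\<Sum>i | i \<in> I \<and> pt i = x. w i)" for x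
  define l where "l x = lq_norm q (x - x0)" for x
  define V where "V = (\<Sum>i\<in>I. (norm (w i))\<^sup>2)"
  define \<beta> where "\<beta> j = (\<Sum>x\<in>pt ` I. l x ^ 3 * \<bar>v j \<bullet> u x\<bar>)" for j
  define T where "T = (\<Sum>x\<in>pt ` I. m (u x) * l x ^ 3)"
  have l: "0 \<le> l x" for x unfolding l_def by (rule lq_norm_nonneg[OF q])
  have V: "0 \<le> V" by (simp add: V_def sum_nonneg)
  have \<beta>: "0 \<le> \<beta> j" for j using l by (simp add: \<beta>_def sum_nonneg)
  have "m 0 = 0" using nonneg[of 0] le_norm[of 0] by simp
  then have m_sum: "m (\<Sum>i\<in>K. w i) \<le> (\<Sum>i\<in>K. m (w i))" for K
    by (induction K rule: infinite_finite_induct) (auto intro: order.trans[OF triangle])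

  \<comment> \<open>Merging weights can only lower the total of \<open>m\<close>, by the triangle
    inequality. Cauchy-Schwarz then turns the sum of norms into the variance term \<open>V\<close>,
    at the cost of a factor \<open>card I\<close>.\<close>
  have "(\<Sum>x\<in>pt ` I. m (u x)) \<le> (\<Sum>x\<in>pt ` I. \<Sum>i | i \<in> I \<and> pt i = x. m (w i))"
    unfolding u_def by (intro sum_mono m_sum)
  also have "\<dots> = (\<Sum>i\<in>I. m (w i))" using I(1) by (rule sum.image_gen[symmetric])
  also have "\<dots> \<le> D * (\<Sum>i\<in>I. norm (w i))"
    unfolding sum_distrib_left by (intro sum_mono le_norm)
  finally have "(\<Sum>x\<in>pt ` I. m (u x))\<^sup>2 \<le> (D * (\<Sum>i\<in>I. norm (w i)))\<^sup>2"
    by (intro power_mono sum_nonneg nonneg)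
  also have "\<dots> \<le> D\<^sup>2 * (V * card I)"
    unfolding power_mult_distrib V_def
    by (intro mult_left_mono sum_squared_le_sum_of_squares) auto
  finally have M: "(\<Sum>x\<in>pt ` I. m (u x))\<^sup>2 \<le> D\<^sup>2 * (V * card I)" .

  have "real (card J) * T \<le> C * (\<Sum>j\<in>J. \<beta> j)"
  proof -
    have "real (card J) * T = (\<Sum>x\<in>pt ` I. l x ^ 3 * (real (card J) * m (u x)))"
      by (simp add: T_def sum_distrib_left mult_ac)
    also have "\<dots> \<le> (\<Sum>x\<in>pt ` I. l x ^ 3 * (C * (\<Sum>j\<in>J. \<bar>v j \<bullet> u x\<bar>)))"
      using l avg unfolding u_def by (intro sum_mono mult_left_mono) auto
    also have "\<dots> = (\<Sum>x\<in>pt ` I. \<Sum>j\<in>J. C * (l x ^ 3 * \<bar>v j \<bullet> u x\<bar>))"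
      by (simp add: sum_distrib_left mult_ac)
    also have "\<dots> = C * (\<Sum>j\<in>J. \<beta> j)"
      by (subst sum.swap) (simp add: \<beta>_def sum_distrib_left)
    finally show ?thesis .
  qed
  \<comment> \<open>If every direction gave less than \<open>T / C\<close>, so would the average;
    hence one direction \<open>j\<close> attains it.\<close>
  moreover have "C * (\<Sum>j\<in>J. \<beta> j) < real (card J) * T" if "\<forall>j\<in>J. C * \<beta> j < T"
    unfolding sum_distrib_left using that J by (intro sum_bounded_above_strict) (auto simp: card_gt_0_iff)
  ultimately have "\<not> (\<forall>j\<in>J. C * \<beta> j < T)" by (meson not_le)
  then obtain j where j: "T \<le> C * \<beta> j" by (auto simp: not_less)

  have "real CARD('p) = (\<Sum>i\<in>I. w i \<bullet> (pt i - x0))"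
    using reproducing_trace[of "\<lambda>i. pt i - x0" w I] True by simp
  also have "\<dots> = (\<Sum>x\<in>pt ` I. \<Sum>i | i \<in> I \<and> pt i = x. w i \<bullet> (pt i - x0))"
    using I(1) by (rule sum.image_gen)
  also have "\<dots> = (\<Sum>x\<in>pt ` I. u x \<bullet> (x - x0))"
    by (intro sum.cong refl) (simp add: u_def inner_sum_left)
  also have "\<dots> \<le> (\<Sum>x\<in>pt ` I. m (u x) * l x)"
    unfolding l_def by (intro sum_mono dual)
  finally have "real CARD('p) ^ 3 \<le> (\<Sum>x\<in>pt ` I. m (u x) * l x) ^ 3"
    by (rule power_mono) simp
  also have "\<dots> \<le> T * (\<Sum>x\<in>pt ` I. m (u x))\<^sup>2"
    unfolding T_def using nonneg l by (rule sum_mult_cube_le)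
  also have "\<dots> \<le> (C * \<beta> j) * (D\<^sup>2 * (V * card I))"
    using j M C \<beta>[of j] by (intro mult_mono) auto
  \<comment> \<open>Cancelling \<open>C * D\<^sup>2\<close> leaves the dimension to the power 3e/2
    as a bound for bias times variance; \<open>risk_tradeoff\<close> raises it to 2/3, which gives
    the power \<open>e\<close>.\<close>
  finally have "C * D\<^sup>2 * real CARD('p) powr (3/2 * e) \<le> C * D\<^sup>2 * (\<beta> j * (real (card I) * V))"
    unfolding C(3) by (simp add: mult_ac)
  then have "real CARD('p) powr (3/2 * e) \<le> \<beta> j * (real (card I) * V)"
    by (rule mult_left_le_imp_le) (use C in auto)
  then have "(real CARD('p) powr (3/2 * e)) powr (2/3)
      * ((3 * a\<^sup>2 * b\<^sup>2 / 16) powr (1/3) * real (card I) powr (-2/3)) \<le> (a / 6 * \<beta> j)\<^sup>2 + b * V"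
    using I \<beta> V ab by (intro risk_tradeoff) (auto simp: card_gt_0_iff)
  then have "ennreal (real CARD('p) powr e *
        ((3 * a\<^sup>2 * b\<^sup>2 / 16) powr (1/3) * real (card I) powr (-2/3))) \<le> ennreal ((a / 6 * \<beta> j)\<^sup>2 + b * V)"
    by (intro ennreal_leI) (simp add: powr_powr)
  also have "\<dots> \<le> worst_risk (class_A a x0 q) (class_B b) x0 I pt (\<lambda>y. \<Sum>i\<in>I. y i *\<^sub>R w i)"
    using worst_risk_ge_bump[OF ab q I(1) v[of j], where pt = pt and ?x0.0 = x0 and w = w]
    by (simp add: \<beta>_def V_def u_def l_def)
  finally show ?thesis .
qed

section \<open>Dual norms and averages over directions\<close>

text \<open>Hoelder's inequality; the first and the third case are one inequality with the roles of
  \<open>u\<close> and \<open>x\<close> exchanged.\<close>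

lemma lq_norm_dual:
  fixes u x :: "real ^ 'p"
  shows "u \<bullet> x \<le> infnorm u * lq_norm 1 x"
    and "u \<bullet> x \<le> norm u * lq_norm 2 x"
    and "u \<bullet> x \<le> (\<Sum>k\<in>UNIV. \<bar>u $ k\<bar>) * lq_norm \<infinity> x"
proof -
  have holder: "v \<bullet> y \<le> (\<Sum>k\<in>UNIV. \<bar>v $ k\<bar>) * infnorm y" for v y :: "real ^ 'p"
  proof -
    have "v \<bullet> y \<le> (\<Sum>k\<in>UNIV. \<bar>v $ k\<bar> * \<bar>y $ k\<bar>)"
      unfolding inner_vec_def by (intro sum_mono) (metis abs_ge_self abs_mult inner_real_def)
    also have "\<dots> \<le> (\<Sum>k\<in>UNIV. \<bar>v $ k\<bar> * infnorm y)"
      by (intro sum_mono mult_left_mono component_le_infnorm) simp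
    finally show ?thesis by (simp add: sum_distrib_right)
  qed
  show "u \<bullet> x \<le> infnorm u * lq_norm 1 x"
    using holder[of x u] by (simp add: lq_norms inner_commute mult.commute)
  show "u \<bullet> x \<le> norm u * lq_norm 2 x"
    by (simp add: lq_norms norm_cauchy_schwarz)
  show "u \<bullet> x \<le> (\<Sum>k\<in>UNIV. \<bar>u $ k\<bar>) * lq_norm \<infinity> x"
    using holder[of u x] by (simp add: lq_norms)
qed

lemma sum_abs_le_norm:
  fixes u :: "real ^ 'p"
  shows "(\<Sum>k\<in>UNIV. \<bar>u $ k\<bar>) \<le> sqrt (real CARD('p)) * norm u"
proof -
  have "(\<Sum>k\<in>UNIV. \<bar>u $ k\<bar>)\<^sup>2 \<le> (\<Sum>k\<in>UNIV. \<bar>u $ k\<bar>\<^sup>2) * real CARD('p)"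
    using sum_squared_le_sum_of_squares[of "\<lambda>k. \<bar>u $ k\<bar>" UNIV] by simp
  also have "\<dots> = (sqrt (real CARD('p)) * norm u)\<^sup>2"
    by (simp add: power_mult_distrib norm_vec_def L2_set_def sum_nonneg)
  finally show ?thesis by (rule power2_le_imp_le) simp
qed

text \<open>The unit diagonals of the cube, one for each sign pattern; \<open>diag UNIV\<close> is
  the main diagonal.\<close>

definition diag :: "'p set \<Rightarrow> real ^ 'p" where
  "diag S = (\<chi> k. (if k \<in> S then 1 else - 1) / sqrt (real CARD('p)))"

lemma norm_diag: "norm (diag S :: real ^ 'p) = 1"
proof -
  have "diag S $ k * diag S $ k = 1 / real CARD('p)" for k
    by (simp add: diag_def)
  then show ?thesis by (simp add: norm_eq_sqrt_inner inner_vec_def)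
qed

text \<open>Flipping all signs but the \<open>k\<close>-th pairs the diagonals, and the inner products of \<open>u\<close> with
  the two members of a pair add up to a multiple of its \<open>k\<close>-th component.\<close>

lemma average_diag:
  fixes u :: "real ^ 'p"
  shows "real (card (UNIV :: 'p set set)) * infnorm u
    \<le> sqrt (real CARD('p)) * (\<Sum>S\<in>UNIV. \<bar>diag S \<bullet> u\<bar>)"
proof -
  let ?r = "sqrt (real CARD('p))"
  define N where "N = real (card (UNIV :: 'p set set))"
  have N: "0 < N" by (simp add: N_def)
  have "\<bar>u $ k\<bar> \<le> ?r * (\<Sum>S\<in>UNIV. \<bar>diag S \<bullet> u\<bar>) / N" for k
  proof -
    define flip where "flip S = {i. (i \<in> S) = (i = k)}" for S :: "'p set"
    \<comment> \<open>\<open>flip\<close> is an involution, so the partners run through all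
      diagonals once.\<close>
    have "(\<Sum>S\<in>UNIV. \<bar>diag (flip S) \<bullet> u\<bar>) = (\<Sum>S\<in>UNIV. \<bar>diag S \<bullet> u\<bar>)"
      by (rule sum.reindex_bij_witness[of _ flip flip]) (auto simp: flip_def)
    moreover have "2 * \<bar>u $ k\<bar> \<le> ?r * (\<bar>diag S \<bullet> u\<bar> + \<bar>diag (flip S) \<bullet> u\<bar>)" for S
    proof -
      have "diag S + diag (flip S) = axis k (2 * (if k \<in> S then 1 else - 1) / ?r)"
        by (auto simp: vec_eq_iff diag_def flip_def axis_def)
      then have "\<bar>(diag S + diag (flip S)) \<bullet> u\<bar> = 2 * \<bar>u $ k\<bar> / ?r"
        by (simp add: inner_axis' abs_mult)
      then show ?thesis
        using mult_left_mono[OF abs_triangle_ineq[of "diag S \<bullet> u" "diag (flip S) \<bullet> u"], of ?r]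
        by (simp add: inner_add_left field_simps)
    qed
    then have "(\<Sum>S\<in>(UNIV :: 'p set set). 2 * \<bar>u $ k\<bar>)
        \<le> (\<Sum>S\<in>UNIV. ?r * (\<bar>diag S \<bullet> u\<bar> + \<bar>diag (flip S) \<bullet> u\<bar>))"
      by (intro sum_mono)
    ultimately have "2 * (N * \<bar>u $ k\<bar>) \<le> 2 * (?r * (\<Sum>S\<in>UNIV. \<bar>diag S \<bullet> u\<bar>))"
      by (simp add: N_def sum.distrib flip: sum_distrib_left)
    then show ?thesis using N by (simp add: field_simps)
  qed
  then have "infnorm u \<le> ?r * (\<Sum>S\<in>UNIV. \<bar>diag S \<bullet> u\<bar>) / N" by (rule infnorm_leI)
  then show ?thesis using N by (simp add: field_simps N_def)
qed

text \<open>Without opposite signs, the sum of the components loses nothing to cancellation, and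
  that sum is the inner product with the main diagonal up to scaling.\<close>

lemma same_sign0_diag:
  fixes u :: "real ^ 'p"
  assumes "same_sign0 u"
  shows "(\<Sum>k\<in>UNIV. \<bar>u $ k\<bar>) = sqrt (real CARD('p)) * \<bar>diag UNIV \<bullet> u\<bar>"
proof -
  have eq: "sqrt (real CARD('p)) * \<bar>diag UNIV \<bullet> u\<bar> = \<bar>\<Sum>k\<in>UNIV. u $ k\<bar>"
    by (simp add: inner_vec_def diag_def abs_divide flip: sum_divide_distrib)
  show ?thesis
  proof (cases "\<exists>k. 0 < u $ k")
    case True
    then obtain k where k: "0 < u $ k" ..
    have "0 \<le> u $ i" for i
      using assms k unfolding same_sign0_def by (metis less_irrefl linorder_not_le order_le_less sgn_greater)
    then show ?thesis unfolding eq by (simp add: sum_nonneg)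
  next
    case False
    then have "\<bar>u $ i\<bar> = - (u $ i)" for i by (simp add: not_less)
    moreover have "(\<Sum>k\<in>UNIV. u $ k) \<le> 0" using False by (intro sum_nonpos) (simp add: not_less)
    ultimately show ?thesis unfolding eq by (simp add: sum_negf)
  qed
qed

lemma norm_le_sum_abs: "norm (u :: real ^ 'p) \<le> (\<Sum>k\<in>UNIV. \<bar>u $ k\<bar>)"
  using L2_set_le_sum_abs[of "\<lambda>k. u $ k" UNIV] by (simp add: norm_vec_def L2_set_def)

text \<open>Here \<open>Q\<close> is the information on the merged weights that the constraint set \<open>C\<close> provides.\<close>

lemma minimax_risk_lower_bound:
  fixes x0 :: "real ^ 'p" and v :: "'j \<Rightarrow> real ^ 'p" and m :: "real ^ 'p \<Rightarrow> real"
  assumes ab: "0 \<le> a" "0 \<le> b" and n: "1 \<le> n" and q: "q \<in> {1, 2, \<infinity>}"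
    and C: "\<And>\<delta> w i. (\<delta>, w) \<in> C \<Longrightarrow> i \<in> {1..n} \<Longrightarrow> Q (\<Sum>j | j \<in> {1..n} \<and> \<delta> j = \<delta> i. w j)"
    and avg: "\<And>u. Q u \<Longrightarrow> real (card J) * m u \<le> real CARD('p) powr c * (\<Sum>j\<in>J. \<bar>v j \<bullet> u\<bar>)"
    and dual: "\<And>u x. u \<bullet> x \<le> m u * lq_norm q x"
    and triangle: "\<And>u u'. m (u + u') \<le> m u + m u'"
    and nonneg: "\<And>u. 0 \<le> m u" and le_norm: "\<And>u. m u \<le> real CARD('p) powr (d / 2) * norm u"
    and J: "finite J" "J \<noteq> {}" and v: "\<And>j. norm (v j) \<le> 1"
    and exponents: "c + d + 3/2 * e = 3"
  shows "ennreal (real CARD('p) powr e * ((3 * a\<^sup>2 * b\<^sup>2 / 16) powr (1/3) * real n powr (-2/3)))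
    \<le> minimax_risk C (class_A a x0 q) (class_B b) x0 n"
  unfolding minimax_risk_def
proof (rule INF_greatest, clarify)
  fix \<delta> w assume \<delta>w: "(\<delta>, w) \<in> C"
  define p where "p = real CARD('p)"
  have p: "0 < p" by (simp add: p_def)
  \<comment> \<open>Exponent bookkeeping for \<open>worst_risk_lower_bound\<close>, with its
    \<open>C\<close> equal to \<open>p powr c\<close> and its \<open>D\<close> equal to
    \<open>p powr (d / 2)\<close>.\<close>
  have "p powr c * (p powr (d / 2))\<^sup>2 * p powr (3/2 * e) = p powr (c + d + 3/2 * e)"
    using p by (simp add: powr_add power2_eq_square flip: powr_add)
  also have "\<dots> = p ^ 3" unfolding exponents using p by simp
  finally have const: "p powr c * (p powr (d / 2))\<^sup>2 * p powr (3/2 * e) = p ^ 3" .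
  \<comment> \<open>Merging by observation point agrees with merging by perturbation, since the two
    differ by the shift \<open>x0\<close>.\<close>
  have avg': "real (card J) * m (\<Sum>j | j \<in> {1..n} \<and> x0 + \<delta> j = x. w j)
      \<le> real CARD('p) powr c * (\<Sum>i\<in>J. \<bar>v i \<bullet> (\<Sum>j | j \<in> {1..n} \<and> x0 + \<delta> j = x. w j)\<bar>)"
    if "x \<in> (\<lambda>j. x0 + \<delta> j) ` {1..n}" for x
  proof -
    obtain i where i: "i \<in> {1..n}" "x = x0 + \<delta> i" using \<open>x \<in> _\<close> by blast
    show ?thesis using avg[OF C[OF \<delta>w i(1)]] by (simp add: i(2))
  qed
  show "ennreal (real CARD('p) powr e * ((3 * a\<^sup>2 * b\<^sup>2 / 16) powr (1/3) * real n powr (-2/3)))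
      \<le> linear_risk (class_A a x0 q) (class_B b) x0 n \<delta> w"
    unfolding linear_risk_def
    using worst_risk_lower_bound[OF ab q finite_atLeastAtMost _ dual triangle nonneg le_norm J v avg' _ _
        const[unfolded p_def]] n p
    by (simp add: p_def)
qed

text \<open>Each case picks \<open>m\<close> as the dual norm of \<open>lq_norm q\<close> together
  with test directions. The exponent \<open>c\<close> is the price of averaging over them,
  \<open>d\<close> that of comparing \<open>m\<close> with the Euclidean norm, and
  \<open>c + d + 3/2 * e = 3\<close> then fixes the rate \<open>e\<close>.\<close>

lemma minimax_risk_lower_bounds:
  fixes x0 :: "real ^ 'p"
  assumes ab: "0 \<le> a" "0 \<le> b" and n: "1 \<le> n"
  defines "p \<equiv> real CARD('p)"
    and "\<kappa> \<equiv> (3 * a\<^sup>2 * b\<^sup>2 / 16) powr (1/3) * real n powr (-2/3)"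
    and "R \<equiv> (\<lambda>C q. minimax_risk C (class_A a x0 q) (class_B b) x0 n)"
  shows "ennreal (p powr (5/3) * \<kappa>) \<le> R C 1"
    and "ennreal (p powr (4/3) * \<kappa>) \<le> R C 2"
    and "ennreal (p powr (2/3) * \<kappa>) \<le> R C \<infinity>"
    and "C \<subseteq> merged_same_sign n \<Longrightarrow> ennreal (p powr (5/3) * \<kappa>) \<le> R C 2"
    and "C \<subseteq> merged_same_sign n \<Longrightarrow> ennreal (p powr 1 * \<kappa>) \<le> R C \<infinity>"
proof -
  have p: "0 < p" by (simp add: p_def)
  have sqrt_p: "sqrt p = p powr (1/2)" using p by (simp add: powr_half_sqrt)
  have l1: "(\<Sum>k\<in>UNIV. \<bar>(u + u') $ k\<bar>) \<le> (\<Sum>k\<in>UNIV. \<bar>u $ k\<bar>) + (\<Sum>k\<in>UNIV. \<bar>u' $ k\<bar>)"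
    for u u' :: "real ^ 'p"
    by (simp add: sum_mono abs_triangle_ineq flip: sum.distrib)
  note l1_norm = sum_abs_le_norm[where 'p = 'p, folded p_def, unfolded sqrt_p]
  have axes: "(\<Sum>k\<in>UNIV. \<bar>axis k 1 \<bullet> u\<bar>) = (\<Sum>k\<in>UNIV. \<bar>u $ k\<bar>)" for u :: "real ^ 'p"
    by (simp add: inner_axis')
  have diag: "(\<Sum>k\<in>UNIV. \<bar>u $ k\<bar>) = p powr (1/2) * \<bar>diag UNIV \<bullet> u\<bar>"
    if "same_sign0 u" for u :: "real ^ 'p"
    using same_sign0_diag[OF that] sqrt_p by (simp add: p_def)
  have merged: "same_sign0 (\<Sum>j | j \<in> {1..n} \<and> \<delta> j = \<delta> i. w j)"
    if "C \<subseteq> merged_same_sign n" "(\<delta>, w) \<in> C" "i \<in> {1..n}" for \<delta> w i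
    using that unfolding merged_same_sign_def by blast
  note bound = minimax_risk_lower_bound[OF ab n, where ?x0.0 = x0 and C = C, folded p_def \<kappa>_def]
  show "ennreal (p powr (5/3) * \<kappa>) \<le> R C 1"
    unfolding R_def
  proof (rule bound[where Q = "\<lambda>_. True" and m = infnorm and v = diag and J = UNIV and c = "1/2" and d = 0])
    show "real (card (UNIV :: 'p set set)) * infnorm u \<le> p powr (1/2) * (\<Sum>S\<in>UNIV. \<bar>diag S \<bullet> u\<bar>)"
      for u :: "real ^ 'p"
      using average_diag[of u, folded p_def, unfolded sqrt_p] .
  qed (use p in \<open>auto simp: norm_diag infnorm_le_norm infnorm_pos_le infnorm_triangle lq_norm_dual\<close>)
  show "ennreal (p powr (4/3) * \<kappa>) \<le> R C 2"
    unfolding R_def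
  proof (rule bound[where Q = "\<lambda>_. True" and m = norm and v = "\<lambda>k. axis k 1" and J = UNIV and c = 1 and d = 0])
    show "real CARD('p) * norm u \<le> p powr 1 * (\<Sum>k\<in>UNIV. \<bar>axis k 1 \<bullet> u\<bar>)" for u :: "real ^ 'p"
      unfolding axes using norm_le_sum_abs[of u] by (simp add: p_def)
  qed (use p in \<open>auto simp: norm_axis_eq norm_triangle_ineq lq_norm_dual\<close>)
  show "ennreal (p powr (2/3) * \<kappa>) \<le> R C \<infinity>"
    unfolding R_def
  proof (rule bound[where Q = "\<lambda>_. True" and m = "\<lambda>u. \<Sum>k\<in>UNIV. \<bar>u $ k\<bar>" and v = "\<lambda>k. axis k 1"
        and J = UNIV and c = 1 and d = 1])
    show "real CARD('p) * (\<Sum>k\<in>UNIV. \<bar>u $ k\<bar>) \<le> p powr 1 * (\<Sum>k\<in>UNIV. \<bar>axis k 1 \<bullet> u\<bar>)"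
      for u :: "real ^ 'p"
      unfolding axes by (simp add: p_def)
  qed (use l1 l1_norm in \<open>auto simp: norm_axis_eq sum_nonneg lq_norm_dual\<close>)
  assume C: "C \<subseteq> merged_same_sign n"
  show "ennreal (p powr (5/3) * \<kappa>) \<le> R C 2"
    unfolding R_def
  proof (rule bound[where Q = same_sign0 and m = norm and v = "\<lambda>_. diag UNIV" and J = "{()}"
        and c = "1/2" and d = 0])
    \<comment> \<open>A single direction suffices under the sign restriction; \<open>c\<close> drops
      from 1 to 1/2, which raises \<open>e\<close> by 1/3.\<close>
    show "real (card {()}) * norm u \<le> p powr (1/2) * (\<Sum>j\<in>{()}. \<bar>diag UNIV \<bullet> u\<bar>)"
      if "same_sign0 u" for u :: "real ^ 'p"
      using diag[OF that] norm_le_sum_abs[of u] by simp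
  qed (use p merged[OF C] in \<open>auto simp: norm_diag norm_triangle_ineq lq_norm_dual\<close>)
  show "ennreal (p powr 1 * \<kappa>) \<le> R C \<infinity>"
    unfolding R_def
  proof (rule bound[where Q = same_sign0 and m = "\<lambda>u. \<Sum>k\<in>UNIV. \<bar>u $ k\<bar>" and v = "\<lambda>_. diag UNIV"
        and J = "{()}" and c = "1/2" and d = 1])
    show "real (card {()}) * (\<Sum>k\<in>UNIV. \<bar>u $ k\<bar>) \<le> p powr (1/2) * (\<Sum>j\<in>{()}. \<bar>diag UNIV \<bullet> u\<bar>)"
      if "same_sign0 u" for u :: "real ^ 'p"
      using diag[OF that] by simp
  qed (use l1 l1_norm merged[OF C] in \<open>auto simp: norm_diag sum_nonneg lq_norm_dual\<close>)
qed

section \<open>The central finite-difference estimator\<close>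

text \<open>The size \<open>p / (n * \<delta>)\<close> is the averaging factor
  \<open>1 / (n / (2 * p))\<close> times \<open>1 / (2 * \<delta>)\<close>.\<close>

definition cfd_weight :: "nat \<Rightarrow> real \<Rightarrow> 'p \<times> nat \<Rightarrow> real ^ 'p" where
  "cfd_weight n \<delta> = (\<lambda>(i, m). axis i ((if odd m then 1 else - 1) * (real CARD('p) / (real n * \<delta>))))"

lemma sum_alternating:
  fixes g :: "nat \<Rightarrow> real"
  shows "(\<Sum>m = 1..2 * K. g m * ((if odd m then 1 else - 1) * c)) = c * (\<Sum>j = 1..K. g (2 * j - 1) - g (2 * j))"
  by (induction K) (simp_all add: distrib_left right_diff_distrib mult_ac)

lemma cfd_estimate_linear:
  fixes y :: "'p::finite \<times> nat \<Rightarrow> real"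
  assumes "2 * CARD('p) dvd n"
  shows "cfd_estimate n \<delta> y = (\<Sum>i\<in>UNIV \<times> {1..n div CARD('p)}. y i *\<^sub>R cfd_weight n \<delta> i)"
proof (rule vec_eq_iff[THEN iffD2], rule allI)
  fix k :: 'p
  obtain K where n: "n = 2 * CARD('p) * K" using assms by (elim dvdE)
  \<comment> \<open>Divisibility makes both integer divisions exact, so that each coordinate has
    \<open>K\<close> complete pairs.\<close>
  have div: "n div CARD('p) = 2 * K" "n div (2 * CARD('p)) = K" by (simp_all add: n)
  let ?c = "real CARD('p) / (real n * \<delta>)"
  have "(\<Sum>i\<in>UNIV \<times> {1..2 * K}. y i *\<^sub>R cfd_weight n \<delta> i) $ k
      = (\<Sum>i\<in>UNIV. \<Sum>m = 1..2 * K. y (i, m) * (cfd_weight n \<delta> (i, m) $ k))"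
    by (simp add: sum.cartesian_product case_prod_unfold)
  also have "\<dots> = (\<Sum>i\<in>UNIV. if i = k then \<Sum>m = 1..2 * K. y (k, m) * ((if odd m then 1 else - 1) * ?c) else 0)"
    by (intro sum.cong refl) (auto simp: cfd_weight_def axis_def)
  also have "\<dots> = ?c * (\<Sum>j = 1..K. y (k, 2 * j - 1) - y (k, 2 * j))"
    by (simp only: sum_alternating sum.delta finite UNIV_I if_True)
  also have "\<dots> = cfd_estimate n \<delta> y $ k"
    by (simp add: cfd_estimate_def div flip: sum_divide_distrib)
  finally show "cfd_estimate n \<delta> y $ k = (\<Sum>i\<in>UNIV \<times> {1..n div CARD('p)}. y i *\<^sub>R cfd_weight n \<delta> i) $ k"
    by (simp only: div)
qed

text \<open>The value at \<open>x0\<close> and the Hessian term are even in the perturbation and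
  cancel in the central difference; the linear term reproduces the gradient. Two remainders are
  left, of the same size for all three norms because the perturbations lie on axes.\<close>

lemma cfd_bias:
  fixes x0 :: "real ^ 'p"
  assumes f: "f \<in> class_A a x0 q" and q: "q \<in> {1, 2, \<infinity>}" and n: "2 * CARD('p) dvd n" "1 \<le> n" and \<delta>: "0 < \<delta>"
  shows "(norm (cfd_estimate n \<delta> (\<lambda>i. f (cfd_point x0 \<delta> i)) - grad f x0))\<^sup>2
    \<le> real CARD('p) * (a / 6 * \<delta>\<^sup>2)\<^sup>2"
proof -
  let ?e = "cfd_estimate n \<delta> (\<lambda>i. f (cfd_point x0 \<delta> i)) - grad f x0"
  obtain K where K: "n = 2 * CARD('p) * K" using n(1) by (elim dvdE)
  then have "0 < K" using n(2) by (cases K) auto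
  obtain H where H: "\<bar>f x - f x0 - grad f x0 \<bullet> (x - x0) - 1/2 * ((x - x0) \<bullet> (H *v (x - x0)))\<bar>
      \<le> a / 6 * lq_norm q (x - x0) ^ 3" for x
    using f unfolding class_A_def by blast
  define r where "r h = f (x0 + h) - f x0 - grad f x0 \<bullet> h - 1/2 * (h \<bullet> (H *v h))" for h
  have r: "\<bar>r h\<bar> \<le> a / 6 * lq_norm q h ^ 3" for h
    using H[of "x0 + h"] by (simp add: r_def)
  have "\<bar>?e $ k\<bar> \<le> a / 6 * \<delta>\<^sup>2" for k
  proof -
    let ?h = "axis k \<delta> :: real ^ 'p"
    have h: "\<delta> *\<^sub>R axis k 1 = ?h" by (simp add: vec_eq_iff axis_def)
    have lq: "lq_norm q ?h = \<delta>" "lq_norm q (- ?h) = \<delta>"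
    proof -
      have neg: "- ?h = axis k (- \<delta>)" by (simp add: vec_eq_iff axis_def)
      show "lq_norm q ?h = \<delta>" "lq_norm q (- ?h) = \<delta>"
        unfolding neg using \<delta> by (simp_all add: lq_norm_axis[OF q])
    qed
    have "?e $ k = (f (x0 + ?h) - f (x0 - ?h)) / (2 * \<delta>) - grad f x0 $ k"
      using \<open>0 < K\<close> by (simp add: cfd_estimate_def K cfd_point_def h)
    also have "\<dots> = (r ?h - r (- ?h)) / (2 * \<delta>)"
      using \<delta> by (simp add: r_def inner_axis linear_neg[OF matrix_vector_mul_linear] field_simps)
    also have "\<bar>\<dots>\<bar> = \<bar>r ?h - r (- ?h)\<bar> / (2 * \<delta>)" using \<delta> by (simp add: abs_divide)
    also have "\<dots> \<le> (a / 6 * \<delta> ^ 3 + a / 6 * \<delta> ^ 3) / (2 * \<delta>)"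
      using r[of ?h] r[of "- ?h"] \<delta> unfolding lq by (intro divide_right_mono) linarith+
    also have "\<dots> = a / 6 * \<delta>\<^sup>2" using \<delta> by (simp add: power2_eq_square power3_eq_cube)
    finally show ?thesis .
  qed
  then have "(?e $ k)\<^sup>2 \<le> (a / 6 * \<delta>\<^sup>2)\<^sup>2" for k
    using power_mono[of "\<bar>?e $ k\<bar>" "a / 6 * \<delta>\<^sup>2" 2] by simp
  then have "(\<Sum>k\<in>UNIV. (?e $ k)\<^sup>2) \<le> (\<Sum>k\<in>(UNIV :: 'p set). (a / 6 * \<delta>\<^sup>2)\<^sup>2)"
    by (rule sum_mono)
  moreover have "(norm ?e)\<^sup>2 = (\<Sum>k\<in>UNIV. (?e $ k)\<^sup>2)"
    by (simp add: norm_vec_def L2_set_def sum_nonneg)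
  ultimately show ?thesis by simp
qed

lemma cfd_risk_le:
  fixes x0 :: "real ^ 'p"
  assumes q: "q \<in> {1, 2, \<infinity>}" and n: "2 * CARD('p) dvd n" "1 \<le> n" and \<delta>: "0 < \<delta>"
  shows "cfd_risk (class_A a x0 q) (class_B b) x0 n \<delta>
    \<le> ennreal (real CARD('p) * ((a / 6 * \<delta>\<^sup>2)\<^sup>2 + b * (real CARD('p) / (real n * \<delta>\<^sup>2))))"
proof -
  let ?I = "UNIV \<times> {1..n div CARD('p)} :: ('p \<times> nat) set"
  have "CARD('p) * (n div CARD('p)) = n" using n(1) dvd_mult_right by (intro dvd_mult_div_cancel)
  then have card: "real (card ?I) = real n"
    by (simp add: card_cartesian_product)
  have variance: "(\<Sum>i\<in>?I. s (cfd_point x0 \<delta> i) * (norm (cfd_weight n \<delta> i))\<^sup>2)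
      \<le> b * real CARD('p) * (real CARD('p) / (real n * \<delta>\<^sup>2))" if "s \<in> class_B b" for s
  proof -
    have "(\<Sum>i\<in>?I. s (cfd_point x0 \<delta> i) * (norm (cfd_weight n \<delta> i))\<^sup>2)
        \<le> (\<Sum>i\<in>?I. b * (real CARD('p) / (real n * \<delta>))\<^sup>2)"
      using that by (intro sum_mono mult_mono)
        (auto simp: class_B_def cfd_weight_def norm_axis_eq power_mult_distrib power_divide intro: order.trans)
    also have "\<dots> = real n * (b * (real CARD('p) / (real n * \<delta>))\<^sup>2)"
      using card by simp
    also have "\<dots> = b * real CARD('p) * (real CARD('p) / (real n * \<delta>\<^sup>2))"
      using n(2) by (simp add: power2_eq_square mult_ac)
    finally show ?thesis .
  qed
  show ?thesis
    unfolding cfd_risk_def worst_risk_def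
  proof (intro SUP_least)
    fix f s D assume f: "f \<in> class_A a x0 q" and s: "s \<in> class_B b" and D: "D \<in> output_laws f s"
    have "(\<integral>\<^sup>+ y. ennreal ((norm (cfd_estimate n \<delta> y - grad f x0))\<^sup>2) \<partial>PiM ?I (\<lambda>i. D (cfd_point x0 \<delta> i)))
        = ennreal ((norm (cfd_estimate n \<delta> (\<lambda>i. f (cfd_point x0 \<delta> i)) - grad f x0))\<^sup>2
          + (\<Sum>i\<in>?I. s (cfd_point x0 \<delta> i) * (norm (cfd_weight n \<delta> i))\<^sup>2))"
      unfolding cfd_estimate_linear[OF n(1)] by (rule nn_integral_linear_estimator[OF D]) simp
    also have "\<dots> \<le> ennreal (real CARD('p) * (a / 6 * \<delta>\<^sup>2)\<^sup>2 + b * real CARD('p) * (real CARD('p) / (real n * \<delta>\<^sup>2)))"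
      using cfd_bias[OF f q n \<delta>] variance[OF s] by (intro ennreal_leI add_mono)
    finally show "(\<integral>\<^sup>+ y. ennreal ((norm (cfd_estimate n \<delta> y - grad f x0))\<^sup>2) \<partial>PiM ?I (\<lambda>i. D (cfd_point x0 \<delta> i)))
        \<le> ennreal (real CARD('p) * ((a / 6 * \<delta>\<^sup>2)\<^sup>2 + b * (real CARD('p) / (real n * \<delta>\<^sup>2))))"
      by (simp add: algebra_simps)
  qed
qed

section \<open>The optimal perturbation size\<close>

text \<open>This \<open>\<delta>\<close> makes the squared bias
  \<open>a\<^sup>2 * \<delta> ^ 4 / 36\<close> half of the variance
  \<open>a\<^sup>2 * \<delta> ^ 4 / 18\<close> in each coordinate, the equality case of
  \<open>risk_tradeoff\<close>.\<close>

lemma optimal_step_size: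
  fixes a b p n :: real
  assumes "0 < a" "0 < b" "0 < p" "0 < n"
  defines "\<delta> \<equiv> (18 * b / a\<^sup>2) powr (1/6) * (1 / (n / p) powr (1/6))"
  shows "p * ((a / 6 * \<delta>\<^sup>2)\<^sup>2 + b * (p / (n * \<delta>\<^sup>2)))
    = p powr (5/3) * ((3 * a\<^sup>2 * b\<^sup>2 / 16) powr (1/3) * n powr (-2/3))" (is "?L = ?R")
proof (rule power_eq_imp_eq_base[of _ 3])
  have pos: "0 < \<delta>" using assms by (simp add: \<delta>_def)
  have pw: "(x powr r) ^ k = x powr (real k * r)" if "0 < x" for x r :: real and k
    using that by (simp add: powr_powr mult.commute flip: powr_realpow)
  have d6: "\<delta> ^ 6 = 18 * b * p / (a\<^sup>2 * n)"
  proof -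
    have "((18 * b / a\<^sup>2) powr (1/6)) ^ 6 = 18 * b / a\<^sup>2" "((n / p) powr (1/6)) ^ 6 = n / p"
      using assms by (simp_all add: pw)
    then show ?thesis by (simp add: \<delta>_def power_mult_distrib power_divide)
  qed
  then have "b * p / n = a\<^sup>2 * \<delta> ^ 6 / 18" using assms by (simp add: field_simps)
  then have "b * (p / (n * \<delta>\<^sup>2)) = a\<^sup>2 * \<delta> ^ 6 / 18 / \<delta>\<^sup>2"
    by (metis divide_divide_eq_left times_divide_eq_right)
  also have "\<dots> = a\<^sup>2 * \<delta> ^ 4 / 18" using pos by (simp add: field_simps flip: power_add)
  finally have "?L = p * ((a / 6 * \<delta>\<^sup>2)\<^sup>2 + a\<^sup>2 * \<delta> ^ 4 / 18)" by simp
  also have "\<dots> = p * a\<^sup>2 * \<delta> ^ 4 / 12"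
    by (simp add: power_mult_distrib power_divide field_simps flip: power_mult)
  finally have "?L ^ 3 = (p * a\<^sup>2 * \<delta> ^ 4 / 12) ^ 3" by (rule arg_cong)
  \<comment> \<open>After cubing, \<open>\<delta>\<close> enters only through
    \<open>\<delta> ^ 6\<close>, which is rational in the data;
    \<open>18\<^sup>2 / 1728 = 3 / 16\<close>.\<close>
  also have "\<dots> = p ^ 3 * a ^ 6 * (\<delta> ^ 6)\<^sup>2 / 1728"
    by (simp add: power_mult_distrib power_divide flip: power_mult)
  also have "\<dots> = p ^ 5 * (3 * a\<^sup>2 * b\<^sup>2 / 16) / n\<^sup>2"
    using assms unfolding d6 by (simp add: power_mult_distrib power_divide field_simps flip: power_add power_mult)
  also have "\<dots> = ?R ^ 3"
  proof -
    have cubes: "(p powr (5/3)) ^ 3 = p ^ 5" "(n powr (-2/3)) ^ 3 = 1 / n\<^sup>2"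
      "((3 * a\<^sup>2 * b\<^sup>2 / 16) powr (1/3)) ^ 3 = 3 * a\<^sup>2 * b\<^sup>2 / 16"
      using assms pw[of n "-2/3" 3] by (simp_all add: pw powr_minus_divide powr_numeral)
    show ?thesis unfolding power_mult_distrib cubes by simp
  qed
  finally show "?L ^ 3 = ?R ^ 3" .
qed (use assms in auto)

section \<open>The CFD estimator as a member of the linear classes\<close>

text \<open>The mean squared error is a function of two sums over the index set, so a bijection
  preserves it and no map between product measures is required.\<close>

lemma worst_risk_reindex:
  fixes w pt :: "'i \<Rightarrow> real ^ 'p" and x0 :: "real ^ 'p"
  assumes h: "bij_betw h K I" and I: "finite I"
  shows "worst_risk A B x0 K (\<lambda>k. pt (h k)) (\<lambda>y. \<Sum>k\<in>K. y k *\<^sub>R w (h k))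
    = worst_risk A B x0 I pt (\<lambda>y. \<Sum>i\<in>I. y i *\<^sub>R w i)"
proof -
  have K: "finite K" using bij_betw_finite[OF h] I by simp
  show ?thesis
    unfolding worst_risk_def
  proof (intro SUP_cong refl)
    fix f s and D :: "real ^ 'p \<Rightarrow> real measure"
    assume D: "D \<in> output_laws f s"
    show "(\<integral>\<^sup>+ y. ennreal ((norm ((\<Sum>k\<in>K. y k *\<^sub>R w (h k)) - grad f x0))\<^sup>2) \<partial>PiM K (\<lambda>k. D (pt (h k))))
        = (\<integral>\<^sup>+ y. ennreal ((norm ((\<Sum>i\<in>I. y i *\<^sub>R w i) - grad f x0))\<^sup>2) \<partial>PiM I (\<lambda>i. D (pt i)))"
      unfolding nn_integral_linear_estimator[OF D I] nn_integral_linear_estimator[OF D K]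
      by (simp add: sum.reindex_bij_betw[OF h, of "\<lambda>i. f (pt i) *\<^sub>R w i"]
          sum.reindex_bij_betw[OF h, of "\<lambda>i. s (pt i) * (norm (w i))\<^sup>2"])
  qed
qed

lemma same_sign0_single: "(\<And>k. k \<noteq> i \<Longrightarrow> v $ k = 0) \<Longrightarrow> same_sign0 v"
  unfolding same_sign0_def by metis

lemma cfd_point_eqD:
  assumes "cfd_point x0 \<delta> i = cfd_point x0 \<delta> j" "\<delta> \<noteq> 0"
  shows "fst i = fst j"
proof (rule ccontr)
  assume "fst i \<noteq> fst j"
  moreover from assms(1) have "cfd_point x0 \<delta> i $ fst i = cfd_point x0 \<delta> j $ fst i" by simp
  ultimately show False
    using assms(2)
    by (simp add: cfd_point_def case_prod_unfold if_distrib[of "\<lambda>x. x $ _"] axis_def split: if_splits)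
qed

text \<open>CFD weights lie on axes, and for \<open>\<delta> \<noteq> 0\<close> points of different
  axes are distinct, so merged weights lie on axes too. The CFD estimator therefore satisfies both
  sign restrictions and competes in the infimum.\<close>

lemma cfd_risk_ge_minimax_risk:
  fixes x0 :: "real ^ 'p"
  assumes n: "2 * CARD('p) dvd n" and \<delta>: "\<delta> \<noteq> 0"
    and C: "sign_restricted same_sign0 n \<inter> merged_same_sign n \<subseteq> C"
  shows "minimax_risk C A B x0 n \<le> cfd_risk A B x0 n \<delta>"
proof -
  let ?I = "UNIV \<times> {1..n div CARD('p)} :: ('p \<times> nat) set"
  have "CARD('p) * (n div CARD('p)) = n" using n dvd_mult_right by (intro dvd_mult_div_cancel)
  then have "card {1..n} = card ?I" by (simp add: card_cartesian_product)
  then obtain h where h: "bij_betw h {1..n} ?I"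
    using finite_same_card_bij[of "{1..n}" ?I] by auto
  define d where "d j = cfd_point x0 \<delta> (h j) - x0" for j
  define w where "w j = cfd_weight n \<delta> (h j)" for j
  have w0: "w j $ k = 0" if "k \<noteq> fst (h j)" for j k
    using that by (simp add: w_def cfd_weight_def case_prod_unfold axis_def)
  have "same_sign0 (\<Sum>j | j \<in> {1..n} \<and> d j = d i. w j)" for i
  proof (rule same_sign0_single[of "fst (h i)"])
    fix k assume k: "k \<noteq> fst (h i)"
    have "w j $ k = 0" if "d j = d i" for j
      using w0 cfd_point_eqD[OF _ \<delta>, of x0 "h j" "h i"] that k by (simp add: d_def)
    then show "(\<Sum>j | j \<in> {1..n} \<and> d j = d i. w j) $ k = 0" by simp
  qed
  then have "(d, w) \<in> sign_restricted same_sign0 n \<inter> merged_same_sign n"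
    using same_sign0_single[OF w0] by (simp add: sign_restricted_def merged_same_sign_def)
  then have "minimax_risk C A B x0 n \<le> linear_risk A B x0 n d w"
    unfolding minimax_risk_def using C by (intro INF_lower2[of "(d, w)"]) auto
  also have "\<dots> = cfd_risk A B x0 n \<delta>"
    unfolding linear_risk_def cfd_risk_def d_def w_def cfd_estimate_linear[OF n]
    using worst_risk_reindex[OF h, of A B x0 "cfd_point x0 \<delta>" "cfd_weight n \<delta>"] by simp
  finally show ?thesis .
qed

section \<open>Comparison of the lower and upper bounds\<close>

theorem theorem2:
  fixes a b \<kappa> p \<delta> :: real and x0 :: "real ^ 'p" and n :: nat
    and R :: "((nat \<Rightarrow> real ^ 'p) \<times> (nat \<Rightarrow> real ^ 'p)) set \<Rightarrow> enat \<Rightarrow> ennreal"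
    and CFD :: "enat \<Rightarrow> ennreal"
  assumes "CARD('p) \<ge> 2" and "a > 0" and "b > 0" and "n \<ge> 1"
  defines "p \<equiv> real CARD('p)"
    and "\<kappa> \<equiv> (3 * a\<^sup>2 * b\<^sup>2 / 16) powr (1/3) * real n powr (-2/3)"
    and "\<delta> \<equiv> (18 * b / a\<^sup>2) powr (1/6) * (1 / (real n / p) powr (1/6))"
    and "R \<equiv> (\<lambda>C q. minimax_risk C (class_A a x0 q) (class_B b) x0 n)"
    and "CFD \<equiv> (\<lambda>q. cfd_risk (class_A a x0 q) (class_B b) x0 n \<delta>)"
  shows
    "(\<forall>q\<in>{1, 2}. R UNIV q \<ge> ennreal (p powr (4/3) * \<kappa>)) \<and>
     R UNIV \<infinity> \<ge> ennreal (p powr (2/3) * \<kappa>) \<and>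

     (2 * CARD('p) dvd n \<longrightarrow>
       (\<forall>q\<in>{1, 2, \<infinity>}. CFD q \<le> ennreal (p powr (5/3) * \<kappa>)) \<and>
       (\<forall>q\<in>{1, 2}. CFD q \<le> ennreal (p powr (1/3)) * R UNIV q) \<and>
       (\<lambda>m. real m powr (1/3)) \<in> o(\<lambda>m. real m) \<and>
       CFD \<infinity> \<le> ennreal p * R UNIV \<infinity>) \<and>

     (\<forall>S\<in>{same_sign, same_sign0}.
       R (sign_restricted S n) 1 \<ge> ennreal (p powr (5/3) * \<kappa>) \<and>
       R (sign_restricted S n \<inter> merged_same_sign n) 2 \<ge> ennreal (p powr (5/3) * \<kappa>) \<and>
       R (sign_restricted S n \<inter> merged_same_sign n) \<infinity> \<ge> ennreal (p * \<kappa>)) \<and>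

     (2 * CARD('p) dvd n \<longrightarrow>
       CFD 1 \<le> R (sign_restricted same_sign n) 1 \<and>
       CFD 2 \<le> R (sign_restricted same_sign n \<inter> merged_same_sign n) 2 \<and>
       CFD 1 = R (sign_restricted same_sign0 n) 1 \<and>
       CFD 2 = R (sign_restricted same_sign0 n \<inter> merged_same_sign n) 2)"
proof -
  have p: "1 \<le> p" "0 < p" using assms(1) by (simp_all add: p_def)
  have \<kappa>: "0 \<le> \<kappa>" by (simp add: \<kappa>_def)
  have \<delta>: "0 < \<delta>" using assms(2-4) p by (simp add: \<delta>_def)
  have "0 \<le> a" "0 \<le> b" using assms(2,3) by auto
  note lower = minimax_risk_lower_bounds[OF this assms(4), where ?x0.0 = x0, folded p_def \<kappa>_def R_def]
  have R: "ennreal (p powr (5/3) * \<kappa>) \<le> R C 1"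
    "ennreal (p powr (4/3) * \<kappa>) \<le> R C 2"
    "ennreal (p powr (2/3) * \<kappa>) \<le> R C \<infinity>"
    "C \<subseteq> merged_same_sign n \<Longrightarrow> ennreal (p powr (5/3) * \<kappa>) \<le> R C 2"
    "C \<subseteq> merged_same_sign n \<Longrightarrow> ennreal (p * \<kappa>) \<le> R C \<infinity>" for C
    using lower[of C] p by (simp_all add: R_def)
  have "ennreal (p powr (4/3) * \<kappa>) \<le> ennreal (p powr (5/3) * \<kappa>)"
    using p \<kappa> by (intro ennreal_leI mult_right_mono powr_mono) auto
  then have R12: "ennreal (p powr (4/3) * \<kappa>) \<le> R C q" if "q \<in> {1, 2}" for C q
    using that R(1,2)[of C] by (auto intro: order.trans)
  \<comment> \<open>The optimality factors come from splitting 5/3 as 1/3 + 4/3 for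
    \<open>q = 1, 2\<close> and as 1 + 2/3 for \<open>q = \<infinity>\<close>.\<close>
  have scale: "ennreal (p powr (r + e) * \<kappa>) \<le> ennreal (p powr r) * R C q"
    if "ennreal (p powr e * \<kappa>) \<le> R C q" for r e C q
    using mult_left_mono[OF that, of "ennreal (p powr r)"] \<kappa>
    by (simp add: powr_add mult.assoc flip: ennreal_mult)
  have CFD: "CFD q \<le> ennreal (p powr (5/3) * \<kappa>)" if "2 * CARD('p) dvd n" "q \<in> {1, 2, \<infinity>}" for q
    using cfd_risk_le[OF that(2,1) assms(4) \<delta>, of a x0 b]
      optimal_step_size[OF assms(2,3) p(2), of "real n"] assms(4)
    by (simp add: CFD_def p_def \<kappa>_def \<delta>_def)
  \<comment> \<open>The reverse inequality, which upgrades the comparison to equality for the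
    constraint sets that admit zero components.\<close>
  have R_le_CFD: "R C q \<le> CFD q"
    if "2 * CARD('p) dvd n" "sign_restricted same_sign0 n \<inter> merged_same_sign n \<subseteq> C" for C q
    unfolding R_def CFD_def using cfd_risk_ge_minimax_risk[OF that(1) _ that(2)] \<delta> by simp
  have "(\<lambda>m. real m powr (1/3)) \<in> o(\<lambda>m. real m)" by real_asymp
  moreover have "CFD q \<le> ennreal (p powr (1/3)) * R UNIV q" if "2 * CARD('p) dvd n" "q \<in> {1, 2}" for q
    using that CFD[OF that(1), of q] scale[OF R12[OF that(2)], of "1/3" UNIV] by (auto intro: order.trans)
  moreover have "CFD \<infinity> \<le> ennreal p * R UNIV \<infinity>" if "2 * CARD('p) dvd n"
    using CFD[OF that, of \<infinity>] scale[OF R(3), of 1 UNIV] p by (auto intro: order.trans)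
  moreover have "CFD 1 \<le> R C 1" if "2 * CARD('p) dvd n" for C
    using order.trans[OF CFD[OF that] R(1)] by simp
  moreover have "CFD 2 \<le> R C 2" if "2 * CARD('p) dvd n" "C \<subseteq> merged_same_sign n" for C
    using order.trans[OF CFD[OF that(1)] R(4)[OF that(2)]] by simp
  moreover have "R (sign_restricted same_sign0 n) 1 \<le> CFD 1"
    "R (sign_restricted same_sign0 n \<inter> merged_same_sign n) 2 \<le> CFD 2" if "2 * CARD('p) dvd n"
    using R_le_CFD[OF that] by auto
  ultimately show ?thesis
    using R R12 CFD by (auto intro!: antisym)
qed

end
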